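(* Let $d\ge 1$ be fixed and, for each $n$, let $W_1,\ldots,W_d\in M_n(\mathbb{C})$ be Hermitian random matrices with $\mathbb{E}(W_i)=0$ for all $i\in[d]$, satisfying Assumptions (A.1), (A.2) and (A.3). Set \[\Delta:=\frac{1}{\sqrt d}\sum_{i\in[d]}\Big(W_i\otimes\overline{W}_i-\mathbb{E}\big(W_i\otimes\overline{W}_i\big)\Big)\in M_{n^2}(\mathbb{C}).\] Let $a_1,\ldots,a_d$ be free self-adjoint variables in a noncommutative probability space $(\mathcal A,\tau)$, with $a_i$ having distribution $\mu_i$. Then, as $n\to\infty$, $\Delta$ converges weakly in probability and in expectation to the distribution of $\frac{1}{\sqrt d}\sum_{i\in[d]}a_i\otimes a_i$ in $(\mathcal A\otimes\mathcal A,\tau\otimes\tau)$, i.e. to the probability measure whose $p$-th moment is \[ d^{-p/2}\sum_{(i_1,\ldots,i_p)\in[d]^p}\tau(a_{i_1}\cdots a_{i_p})^2 \quad (p\ge 1).\] (In the paper's notation this limit is the tensor convolution $\tilde\mu_1\circledast\cdots\circledast\tilde\mu_d$ of the dilations of the $\mu_i$.)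
   Context: Notation: $[d]=\{1,\ldots,d\}$; $\overline{W}$ is the entrywise complex conjugate; $\tau^{(N)}(M)=\frac1N\operatorname{tr}(M)$ for $M\in M_N(\mathbb{C})$. A noncommutative probability space $(\mathcal A,\tau)$ is a unital algebra with a linear tracial state $\tau$ ($\tau(1)=1$, $\tau(ab)=\tau(ba)$); subalgebras $\mathcal A_1,\ldots,\mathcal A_d$ are free if $\tau(x_1\cdots x_p)=0$ whenever $x_k\in\mathcal A_{j_k}$, $\tau(x_k)=0$ for all $k$, and $j_1\ne j_2\ne\cdots\ne j_p$ (consecutive indices distinct); variables are free if the unital algebras they generate are free. The distribution of a self-adjoint $a$ is the probability measure $\mu$ on $\mathbb R$ with $\tau(a^p)=\int x^p\,d\mu$ for all $p$. A sequence of random Hermitian matrices $M_N\in M_N(\mathbb{C})$ with $\operatorname{tr}(M_N^p)$ integrable for all $p$ converges weakly in probability (resp. in expectation) to a probability measure $\mu$ with all moments finite if for every $p\ge1$, $\tau^{(N)}(M_N^p)\to\int x^p\,d\mu$ in probability (resp. $\mathbb{E}\,\tau^{(N)}(M_N^p)\to\int x^p d\mu$). Hermitian random matrices $M_1,\ldots,M_d\in M_n(\mathbb{C})$ are asymptotically free in probability if for all $m\ge1$, $i_1\ne i_2\ne\cdots\ne i_m\in[d]$ and $p_1,\ldots,p_m\ge1$, $\tau^{(n)}\big((M_{i_1}^{p_1}-\tau^{(n)}(M_{i_1}^{p_1}))\cdots(M_{i_m}^{p_m}-\tau^{(n)}(M_{i_m}^{p_m}))\big)\to0$ in probability as $n\to\infty$;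 asymptotically free in expectation if $\mathbb{E}\,\tau^{(n)}\big((M_{i_1}^{p_1}-\mathbb{E}\tau^{(n)}(M_{i_1}^{p_1}))\cdots(M_{i_m}^{p_m}-\mathbb{E}\tau^{(n)}(M_{i_m}^{p_m}))\big)\to0$. Assumptions on Hermitian random matrices $W_1,\ldots,W_d\in M_n(\mathbb{C})$: (A.1) for each $i\in[d]$, $W_i$ converges weakly in probability and in expectation to a probability measure $\mu_i$ on $\mathbb R$; (A.2) the family $(W_i)_{i\in[d]}$ is asymptotically free in probability and in expectation (for each fixed $d$); (A.3) for each $i\in[d]$, the deterministic Hermitian matrix $\mathbb{E}(W_i\otimes\overline{W}_i)\in M_{n^2}(\mathbb{C})$ converges weakly to $\delta_0$, i.e. $\tau^{(n^2)}\big((\mathbb{E}(W_i\otimes\overline W_i))^p\big)\to0$ for all $p\ge1$; (A.4) the matrices $(W_i)_{i\in[d]}$ are independent and identically distributed. *)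

theory Defs
  imports "HOL-Probability.Probability" "Jordan_Normal_Form.Schur_Decomposition"
begin

definition mtrace :: "complex mat \<Rightarrow> complex" where
  "mtrace A = (\<Sum>i<dim_row A. A $$ (i, i))"

definition ntrace :: "complex mat \<Rightarrow> complex" where
  "ntrace A = mtrace A / of_nat (dim_row A)"

definition mat_conj :: "complex mat \<Rightarrow> complex mat" where
  "mat_conj A = map_mat cnj A"

definition kron :: "complex mat \<Rightarrow> complex mat \<Rightarrow> complex mat" where
  "kron A B = mat (dim_row A * dim_row B) (dim_col A * dim_col B)
     (\<lambda>(i, j). A $$ (i div dim_row B, j div dim_col B) * B $$ (i mod dim_row B, j mod dim_col B))"

definition mat_prod_list :: "nat \<Rightarrow> complex mat list \<Rightarrow> complex mat" where
  "mat_prod_list N As = foldr (\<lambda>A B. A * B) As (1\<^sub>m N)"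

definition mat_sum :: "nat \<Rightarrow> ('i \<Rightarrow> complex mat) \<Rightarrow> 'i set \<Rightarrow> complex mat" where
  "mat_sum N f I = mat N N (\<lambda>jk. \<Sum>i\<in>I. f i $$ jk)"

definition mat_expect :: "'a measure \<Rightarrow> nat \<Rightarrow> ('a \<Rightarrow> complex mat) \<Rightarrow> complex mat" where
  "mat_expect M N X = mat N N (\<lambda>jk. \<integral>\<omega>. X \<omega> $$ jk \<partial>M)"

definition conv_in_prob :: "(nat \<Rightarrow> 'a measure) \<Rightarrow> (nat \<Rightarrow> 'a \<Rightarrow> complex) \<Rightarrow> complex \<Rightarrow> bool" where
  "conv_in_prob M Y c \<longleftrightarrow>
     (\<forall>n. Y n \<in> borel_measurable (M n)) \<and>
     (\<forall>\<epsilon>>0. (\<lambda>n. measure (M n) {\<omega> \<in> space (M n). \<epsilon> < cmod (Y n \<omega> - c)}) \<longlonglongrightarrow> 0)"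

definition conv_in_exp :: "(nat \<Rightarrow> 'a measure) \<Rightarrow> (nat \<Rightarrow> 'a \<Rightarrow> complex) \<Rightarrow> complex \<Rightarrow> bool" where
  "conv_in_exp M Y c \<longleftrightarrow>
     (\<forall>n. integrable (M n) (Y n)) \<and> (\<lambda>n. \<integral>\<omega>. Y n \<omega> \<partial>M n) \<longlonglongrightarrow> c"

definition moment_measure :: "real measure \<Rightarrow> bool" where
  "moment_measure \<mu> \<longleftrightarrow> real_distribution \<mu> \<and> (\<forall>p::nat. integrable \<mu> (\<lambda>x. x ^ p))"

definition weak_conv_prob ::
  "(nat \<Rightarrow> 'a measure) \<Rightarrow> (nat \<Rightarrow> 'a \<Rightarrow> complex mat) \<Rightarrow> real measure \<Rightarrow> bool" where
  "weak_conv_prob M X \<mu> \<longleftrightarrow> moment_measure \<mu> \<and>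
     (\<forall>n p. integrable (M n) (\<lambda>\<omega>. mtrace (X n \<omega> ^\<^sub>m p))) \<and>
     (\<forall>p\<ge>1. conv_in_prob M (\<lambda>n \<omega>. ntrace (X n \<omega> ^\<^sub>m p)) (complex_of_real (\<integral>x. x ^ p \<partial>\<mu>)))"

definition weak_conv_exp ::
  "(nat \<Rightarrow> 'a measure) \<Rightarrow> (nat \<Rightarrow> 'a \<Rightarrow> complex mat) \<Rightarrow> real measure \<Rightarrow> bool" where
  "weak_conv_exp M X \<mu> \<longleftrightarrow> moment_measure \<mu> \<and>
     (\<forall>n p. integrable (M n) (\<lambda>\<omega>. mtrace (X n \<omega> ^\<^sub>m p))) \<and>
     (\<forall>p\<ge>1. conv_in_exp M (\<lambda>n \<omega>. ntrace (X n \<omega> ^\<^sub>m p)) (complex_of_real (\<integral>x. x ^ p \<partial>\<mu>)))"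

definition adm_words :: "nat \<Rightarrow> nat list \<Rightarrow> nat list \<Rightarrow> bool" where
  "adm_words d is ps \<longleftrightarrow> is \<noteq> [] \<and> length ps = length is \<and> set is \<subseteq> {..<d} \<and>
     (\<forall>k. Suc k < length is \<longrightarrow> is ! k \<noteq> is ! Suc k) \<and> (\<forall>p\<in>set ps. 1 \<le> p)"

definition asym_free_prob ::
  "(nat \<Rightarrow> 'a measure) \<Rightarrow> (nat \<Rightarrow> nat) \<Rightarrow> nat \<Rightarrow> (nat \<Rightarrow> nat \<Rightarrow> 'a \<Rightarrow> complex mat) \<Rightarrow> bool" where
  "asym_free_prob M N d W \<longleftrightarrow> (\<forall>is ps. adm_words d is ps \<longrightarrow>
     conv_in_prob M (\<lambda>n \<omega>. ntrace (mat_prod_list (N n)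
        (map (\<lambda>(i, p). W n i \<omega> ^\<^sub>m p - ntrace (W n i \<omega> ^\<^sub>m p) \<cdot>\<^sub>m 1\<^sub>m (N n)) (zip is ps)))) 0)"

definition asym_free_exp ::
  "(nat \<Rightarrow> 'a measure) \<Rightarrow> (nat \<Rightarrow> nat) \<Rightarrow> nat \<Rightarrow> (nat \<Rightarrow> nat \<Rightarrow> 'a \<Rightarrow> complex mat) \<Rightarrow> bool" where
  "asym_free_exp M N d W \<longleftrightarrow> (\<forall>is ps. adm_words d is ps \<longrightarrow>
     conv_in_exp M (\<lambda>n \<omega>. ntrace (mat_prod_list (N n)
        (map (\<lambda>(i, p). W n i \<omega> ^\<^sub>m p - (\<integral>\<omega>'. ntrace (W n i \<omega>' ^\<^sub>m p) \<partial>M n) \<cdot>\<^sub>m 1\<^sub>m (N n))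
             (zip is ps)))) 0)"

definition nc_prob_space ::
  "(complex \<Rightarrow> 'b::ring_1 \<Rightarrow> 'b) \<Rightarrow> ('b \<Rightarrow> 'b) \<Rightarrow> ('b \<Rightarrow> complex) \<Rightarrow> bool" where
  "nc_prob_space sc star \<tau> \<longleftrightarrow>
     (\<forall>x. sc 1 x = x) \<and>
     (\<forall>a b x. sc a (sc b x) = sc (a * b) x) \<and>
     (\<forall>a b x. sc (a + b) x = sc a x + sc b x) \<and>
     (\<forall>a x y. sc a (x + y) = sc a x + sc a y) \<and>
     (\<forall>a x y. sc a (x * y) = sc a x * y \<and> sc a (x * y) = x * sc a y) \<and>
     (\<forall>x. star (star x) = x) \<and>
     (\<forall>x y. star (x + y) = star x + star y) \<and>
     (\<forall>x y. star (x * y) = star y * star x) \<and>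
     (\<forall>a x. star (sc a x) = sc (cnj a) (star x)) \<and>
     (\<forall>x y. \<tau> (x + y) = \<tau> x + \<tau> y) \<and>
     (\<forall>a x. \<tau> (sc a x) = a * \<tau> x) \<and>
     \<tau> 1 = 1 \<and>
     (\<forall>x y. \<tau> (x * y) = \<tau> (y * x)) \<and>
     (\<forall>x. Im (\<tau> (star x * x)) = 0 \<and> 0 \<le> Re (\<tau> (star x * x)))"

definition alg_gen :: "(complex \<Rightarrow> 'b::ring_1 \<Rightarrow> 'b) \<Rightarrow> 'b \<Rightarrow> 'b set" where
  "alg_gen sc x = {y. \<exists>c N. y = (\<Sum>k\<le>N. sc (c k) (x ^ k))}"

definition free_vars ::
  "(complex \<Rightarrow> 'b::ring_1 \<Rightarrow> 'b) \<Rightarrow> ('b \<Rightarrow> complex) \<Rightarrow> 'i set \<Rightarrow> ('i \<Rightarrow> 'b) \<Rightarrow> bool" where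
  "free_vars sc \<tau> I a \<longleftrightarrow> (\<forall>xs js. xs \<noteq> [] \<and> length js = length xs \<and> set js \<subseteq> I \<and>
     (\<forall>k<length xs. xs ! k \<in> alg_gen sc (a (js ! k)) \<and> \<tau> (xs ! k) = 0) \<and>
     (\<forall>k. Suc k < length js \<longrightarrow> js ! k \<noteq> js ! Suc k) \<longrightarrow> \<tau> (prod_list xs) = 0)"

end

theory Submission
  imports Defs
begin

text \<open>Write \<open>X\<^sub>i = W\<^sub>i \<otimes> cnj W\<^sub>i\<close> and \<open>E\<^sub>i\<close> for its mean. Expanding the traces of powers of
  \<open>\<Delta>\<close> gives traces of words in the \<open>X\<^sub>i\<close> and \<open>E\<^sub>i\<close>. By the Cauchy-Schwarz and Hoelder inequalities, the
  squared trace of a word containing some \<open>E\<^sub>i\<close> is at most \<open>tr (E\<^sub>i\<^sup>2)\<close> times moments that stay bounded, so only words in the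
  \<open>X\<^sub>i\<close> survive; their trace is the squared modulus of the trace of the same word in the \<open>W\<^sub>i\<close>, which
  converges by asymptotic freeness. The same Hoelder bound dominates the squares of all these traces
  by random variables with bounded mean, so convergence in probability implies convergence in
  expectation. The limiting moments are moments of a measure because they are limits of moments of spectral
  distributions of Hermitian matrices, which are tight.\<close>

section \<open>Traces of complex matrices\<close>

text \<open>Only tracial moments of the \<open>W n i\<close> and of the means are controlled, not
  their operator norms, so no factor of a word can be pulled out by a norm bound; Hoelder's
  inequality for traces is the substitute. Its halving induction is the origin of the powers of two.
  Convergence of expectations does not pass through the squared modulus that the trace of a
  Kronecker square produces, whereas convergence in probability does. Limits are therefore taken in
  probability, and expectations are recovered by domination. For the dominating variable to have
  bounded mean it must be linear in traces of powers of the \<open>W n i\<close>; the bound |tr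
  W^q|^2 \<le> tr W^(2q) makes it so, at the price of doubled exponents. The limit of a squared
  modulus is the square in the stated moments because mixed moments of free variables are
  polynomials with real coefficients in the real moments of the single variables.\<close>

lemma dim_mat_adjoint [simp]: "dim_row (mat_adjoint A) = dim_col A" "dim_col (mat_adjoint A) = dim_row A"
  by (auto simp: mat_adjoint_def)

lemma mat_adjoint_carrier [simp]: "A \<in> carrier_mat m n \<Longrightarrow> mat_adjoint A \<in> carrier_mat n m"
  by auto

lemma index_mat_adjoint:
  fixes A :: "complex mat"
  shows "i < dim_col A \<Longrightarrow> j < dim_row A \<Longrightarrow> mat_adjoint A $$ (i, j) = cnj (A $$ (j, i))"
  by (simp add: mat_adjoint_def mat_of_rows_def)

lemma mat_adjoint_adjoint:
  fixes A :: "complex mat"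
  shows "mat_adjoint (mat_adjoint A) = A"
  by (rule eq_matI) (auto simp: index_mat_adjoint)

lemma index_mult_mat_sum:
  assumes "A \<in> carrier_mat l m" "B \<in> carrier_mat m n" "i < l" "j < n"
  shows "(A * B) $$ (i, j) = (\<Sum>k<m. A $$ (i, k) * B $$ (k, j))"
  using assms by (auto simp: scalar_prod_def lessThan_atLeast0)

lemma mat_adjoint_mult:
  fixes A B :: "complex mat"
  assumes A: "A \<in> carrier_mat l m" and B: "B \<in> carrier_mat m n"
  shows "mat_adjoint (A * B) = mat_adjoint B * mat_adjoint A"
proof (rule eq_matI)
  fix i j assume "i < dim_row (mat_adjoint B * mat_adjoint A)" "j < dim_col (mat_adjoint B * mat_adjoint A)"
  then have ij: "i < n" "j < l" using A B by auto
  have "mat_adjoint (A * B) $$ (i, j) = cnj ((A * B) $$ (j, i))"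
    using A B ij by (intro index_mat_adjoint) auto
  also have "\<dots> = (\<Sum>k<m. cnj (A $$ (j, k)) * cnj (B $$ (k, i)))"
    using A B ij by (subst index_mult_mat_sum[OF A B]) auto
  also have "\<dots> = (\<Sum>k<m. mat_adjoint B $$ (i, k) * mat_adjoint A $$ (k, j))"
    using A B ij by (intro sum.cong refl) (simp add: index_mat_adjoint)
  also have "\<dots> = (mat_adjoint B * mat_adjoint A) $$ (i, j)"
    using A B ij by (subst index_mult_mat_sum[of _ n m _ l]) auto
  finally show "mat_adjoint (A * B) $$ (i, j) = (mat_adjoint B * mat_adjoint A) $$ (i, j)" .
qed (use A B in auto)

lemma ntrace_sum: "A \<in> carrier_mat N N \<Longrightarrow> ntrace A = (\<Sum>i<N. A $$ (i, i)) / of_nat N"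
  by (auto simp: ntrace_def mtrace_def)

lemma mtrace_eq_ntrace: "A \<in> carrier_mat N N \<Longrightarrow> mtrace A = of_nat N * ntrace A"
  by (auto simp: ntrace_def mtrace_def)

lemma ntrace_mult:
  assumes A: "A \<in> carrier_mat N N" and B: "B \<in> carrier_mat N N"
  shows "ntrace (A * B) = (\<Sum>i<N. \<Sum>k<N. A $$ (i, k) * B $$ (k, i)) / of_nat N"
  using A B by (subst ntrace_sum[of _ N]) (auto simp: index_mult_mat_sum[OF A B] simp del: index_mult_mat)

lemma ntrace_mult_commute:
  assumes A: "A \<in> carrier_mat N N" and B: "B \<in> carrier_mat N N"
  shows "ntrace (A * B) = ntrace (B * A)"
  unfolding ntrace_mult[OF A B] ntrace_mult[OF B A]
  by (subst sum.swap) (simp add: mult.commute)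

lemma ntrace_add:
  "A \<in> carrier_mat N N \<Longrightarrow> B \<in> carrier_mat N N \<Longrightarrow> ntrace (A + B) = ntrace A + ntrace B"
  by (subst (1 2 3) ntrace_sum[of _ N]) (auto simp: sum.distrib add_divide_distrib)

lemma ntrace_diff:
  "A \<in> carrier_mat N N \<Longrightarrow> B \<in> carrier_mat N N \<Longrightarrow> ntrace (A - B) = ntrace A - ntrace B"
  by (subst (1 2 3) ntrace_sum[of _ N]) (auto simp: sum_subtractf diff_divide_distrib)

lemma ntrace_smult: "A \<in> carrier_mat N N \<Longrightarrow> ntrace (c \<cdot>\<^sub>m A) = c * ntrace A"
  by (subst (1 2) ntrace_sum[of _ N]) (auto simp: sum_distrib_left)

lemma ntrace_one: "0 < N \<Longrightarrow> ntrace (1\<^sub>m N) = 1"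
  by (subst ntrace_sum[of _ N]) auto

lemma ntrace_adjoint_mult_self:
  assumes A: "A \<in> carrier_mat N N"
  shows "ntrace (mat_adjoint A * A) = of_real ((\<Sum>i<N. \<Sum>k<N. (cmod (A $$ (k, i)))\<^sup>2) / real N)"
  using A by (subst ntrace_mult[of _ N])
    (auto simp: index_mat_adjoint complex_norm_square mult.commute simp del: of_real_power intro!: sum.cong)

text \<open>Entries of \<open>A\<close> and of the transpose of \<open>B\<close>, read as vectors
  indexed by pairs, have the unnormalized trace as their product: this is the Frobenius pairing. The
  squared form keeps roots out of all later estimates.\<close>

lemma ntrace_Cauchy_Schwarz:
  assumes A: "A \<in> carrier_mat N N" and B: "B \<in> carrier_mat N N"
  shows "(cmod (ntrace (A * B)))\<^sup>2
    \<le> Re (ntrace (mat_adjoint A * A)) * Re (ntrace (mat_adjoint B * B))"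
proof -
  let ?I = "{..<N} \<times> {..<N}"
  let ?f = "\<lambda>(i, k). cmod (A $$ (i, k))" and ?g = "\<lambda>(i, k). cmod (B $$ (k, i))"
  have sumA: "(\<Sum>p\<in>?I. (?f p)\<^sup>2) = (\<Sum>i<N. \<Sum>k<N. (cmod (A $$ (k, i)))\<^sup>2)"
    by (subst sum.swap) (simp add: sum.cartesian_product case_prod_unfold)
  have sumB: "(\<Sum>p\<in>?I. (?g p)\<^sup>2) = (\<Sum>i<N. \<Sum>k<N. (cmod (B $$ (k, i)))\<^sup>2)"
    by (simp add: sum.cartesian_product case_prod_unfold)
  have "cmod (ntrace (A * B)) * real N \<le> (\<Sum>p\<in>?I. ?f p * ?g p)"
  proof -
    have "cmod (ntrace (A * B)) * real N \<le> cmod (\<Sum>i<N. \<Sum>k<N. A $$ (i, k) * B $$ (k, i))"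
      by (simp add: ntrace_mult[OF A B] norm_divide)
    also have "\<dots> = cmod (\<Sum>p\<in>?I. case p of (i, k) \<Rightarrow> A $$ (i, k) * B $$ (k, i))"
      by (simp add: sum.cartesian_product)
    also have "\<dots> \<le> (\<Sum>p\<in>?I. ?f p * ?g p)"
      by (intro order_trans[OF norm_sum] sum_mono) (auto simp: norm_mult)
    finally show ?thesis .
  qed
  then have "(cmod (ntrace (A * B)) * real N)\<^sup>2 \<le> (\<Sum>p\<in>?I. ?f p * ?g p)\<^sup>2"
    by (intro power_mono) auto
  also have "\<dots> \<le> (\<Sum>p\<in>?I. (?f p)\<^sup>2) * (\<Sum>p\<in>?I. (?g p)\<^sup>2)"
    by (rule Cauchy_Schwarz_ineq_sum)
  finally have *: "(cmod (ntrace (A * B)))\<^sup>2 * (real N * real N)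
      \<le> (\<Sum>i<N. \<Sum>k<N. (cmod (A $$ (k, i)))\<^sup>2) * (\<Sum>i<N. \<Sum>k<N. (cmod (B $$ (k, i)))\<^sup>2)"
    by (simp only: sumA sumB power_mult_distrib power2_eq_square[of "real N"])
  show ?thesis
  \<comment> \<open>Empty matrices occur since the index \<open>n\<close> starts at 0; division by
    zero makes both sides vanish.\<close>
  proof (cases "N = 0")
    case True
    then show ?thesis using A B by (simp add: ntrace_def)
  next
    case False
    then show ?thesis
      unfolding ntrace_adjoint_mult_self[OF A] ntrace_adjoint_mult_self[OF B]
      using * by (simp add: field_simps)
  qed
qed

section \<open>Products along lists of matrices\<close>

lemma mat_prod_list_simps [simp]:
  "mat_prod_list N [] = 1\<^sub>m N"
  "mat_prod_list N (A # As) = A * mat_prod_list N As"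
  by (simp_all add: mat_prod_list_def)

lemma mat_prod_list_carrier [simp]:
  "set As \<subseteq> carrier_mat N N \<Longrightarrow> mat_prod_list N As \<in> carrier_mat N N"
  by (induction As) auto

lemma mat_prod_list_append:
  "set As \<subseteq> carrier_mat N N \<Longrightarrow> set Bs \<subseteq> carrier_mat N N \<Longrightarrow>
    mat_prod_list N (As @ Bs) = mat_prod_list N As * mat_prod_list N Bs"
  by (induction As) (auto simp: assoc_mult_mat[of _ N N _ N _ N] left_mult_one_mat[of _ N N])

lemma mat_adjoint_one: "mat_adjoint (1\<^sub>m N) = (1\<^sub>m N :: complex mat)"
  by (rule eq_matI) (auto simp: index_mat_adjoint)

lemma mat_adjoint_prod_list:
  "set As \<subseteq> carrier_mat N N \<Longrightarrow>
    mat_adjoint (mat_prod_list N As) = mat_prod_list N (rev (map mat_adjoint As))"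
proof (induction As)
  case (Cons A As)
  then have "set (rev (map mat_adjoint As)) \<subseteq> carrier_mat N N" by auto
  with Cons show ?case
    by (simp add: mat_adjoint_mult[of _ N N _ N] mat_prod_list_append right_mult_one_mat[of _ N N])
qed (simp add: mat_adjoint_one)

lemma mat_prod_list_replicate:
  assumes A: "A \<in> carrier_mat N N"
  shows "mat_prod_list N (replicate m A) = A ^\<^sub>m m"
proof (induction m)
  case (Suc m)
  have "mat_prod_list N (replicate (Suc m) A) = mat_prod_list N (replicate m A @ [A])"
    by (simp add: replicate_append_same)
  also have "\<dots> = A ^\<^sub>m m * A"
    using A by (subst mat_prod_list_append) (auto simp: Suc)
  finally show ?case by simp
qed (use A in auto)

lemma pow_mat_Suc_left: "A \<in> carrier_mat N N \<Longrightarrow> A ^\<^sub>m Suc m = A * A ^\<^sub>m m" for A :: "complex mat"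
  using mat_prod_list_replicate[of A N "Suc m"] mat_prod_list_replicate[of A N m] by simp

lemma pow_mat_add: "A \<in> carrier_mat N N \<Longrightarrow> A ^\<^sub>m (k + m) = A ^\<^sub>m k * A ^\<^sub>m m" for A :: "complex mat"
  by (induction m) (auto simp: assoc_mult_mat[of _ N N _ N _ N])

lemma pow_mat_square:
  fixes P :: "complex mat"
  assumes P: "P \<in> carrier_mat N N"
  shows "(P * P) ^\<^sub>m m = P ^\<^sub>m (2 * m)"
  by (induction m) (use P in \<open>auto simp: assoc_mult_mat[of _ N N _ N _ N]\<close>)

text \<open>Presents a power of a product as a word, the shape in which an inductive bound on traces
  of words can be applied to it.\<close>

lemma mat_prod_list_alternating:
  assumes P: "P \<in> carrier_mat N N" and Q: "Q \<in> carrier_mat N N"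
  shows "mat_prod_list N (concat (replicate m [P, Q])) = (P * Q) ^\<^sub>m m"
proof (induction m)
  case (Suc m)
  then show ?case
    using P Q by (subst pow_mat_Suc_left[of _ N]) (auto simp: assoc_mult_mat[of _ N N _ N _ N])
qed (use P in auto)

text \<open>The identity (XY)^k X = X (YX)^k lets a single factor travel around the trace. It trades
  \<open>mat_adjoint A * A\<close> for \<open>A * mat_adjoint A\<close> inside a power, although the
  two matrices differ.\<close>

lemma ntrace_pow_mult_commute:
  assumes X: "X \<in> carrier_mat N N" and Y: "Y \<in> carrier_mat N N"
  shows "ntrace ((X * Y) ^\<^sub>m m) = ntrace ((Y * X) ^\<^sub>m m)"
proof (cases m)
  case (Suc k)
  have swap: "(X * Y) ^\<^sub>m k * X = X * (Y * X) ^\<^sub>m k"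
  proof (induction k)
    case (Suc k)
    have "(X * Y) ^\<^sub>m Suc k * X = ((X * Y) ^\<^sub>m k * X) * (Y * X)"
      using X Y by (simp add: assoc_mult_mat[of _ N N _ N _ N])
    then show ?case
      using X Y by (simp add: Suc assoc_mult_mat[of _ N N _ N _ N])
  qed (use X Y in auto)
  have "(X * Y) ^\<^sub>m m = X * ((Y * X) ^\<^sub>m k * Y)"
    using X Y swap by (simp add: Suc assoc_mult_mat[of _ N N _ N _ N, symmetric])
  then have "ntrace ((X * Y) ^\<^sub>m m) = ntrace (((Y * X) ^\<^sub>m k * Y) * X)"
    using X Y by (simp only:) (rule ntrace_mult_commute[of _ N], auto)
  then show ?thesis
    using X Y by (simp add: Suc assoc_mult_mat[of _ N N _ N _ N])
qed (use X Y in auto)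

section \<open>Hoelder's inequality for traces of words\<close>

fun pair_products :: "complex mat list \<Rightarrow> complex mat list" where
  "pair_products (A # B # As) = A * B # pair_products As"
| "pair_products _ = []"

lemma length_pair_products: "length (pair_products As) = length As div 2"
  by (induction As rule: pair_products.induct) auto

lemma set_pair_products: "X \<in> set (pair_products As) \<Longrightarrow> \<exists>A\<in>set As. \<exists>B\<in>set As. X = A * B"
  by (induction As rule: pair_products.induct) auto

text \<open>A last unpaired factor would be dropped by \<open>pair_products\<close>; evenness
  excludes this, and the rest is associativity.\<close>

lemma mat_prod_list_pair_products:
  "set As \<subseteq> carrier_mat N N \<Longrightarrow> even (length As) \<Longrightarrow>
    mat_prod_list N (pair_products As) = mat_prod_list N As"
  by (induction As rule: pair_products.induct) (auto simp: assoc_mult_mat[of _ N N _ N _ N])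

text \<open>Hoelder's inequality for normalized Schatten norms, in a form that avoids roots: a product of
  \<open>2 ^ Suc k\<close> matrices is bounded by the largest of their power sums. Multiplying neighbours halves
  the length, and \<open>tr ((AB)\<^sup>*AB) ^ 2 ^ k\<close> is the trace of an alternating product in
  \<open>A\<^sup>*A\<close> and \<open>BB\<^sup>*\<close>, to which the induction hypothesis applies as well.\<close>
lemma ntrace_prod_le_max:
  assumes "length As = 2 ^ Suc k" "set As \<subseteq> carrier_mat N N"
    and "\<And>A. A \<in> set As \<Longrightarrow> Re (ntrace ((mat_adjoint A * A) ^\<^sub>m (2 ^ k))) \<le> C"
  shows "cmod (ntrace (mat_prod_list N As)) \<le> C"
  using assms
proof (induction k arbitrary: As)
  case 0
  then obtain A B where As: "As = [A, B]"
    by (auto simp: length_Suc_conv numeral_2_eq_2)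
  then have A: "A \<in> carrier_mat N N" and B: "B \<in> carrier_mat N N" using 0 by auto
  have "mat_adjoint X * X \<in> carrier_mat N N" if "X \<in> {A, B}" for X
    using that A B by auto
  then have le: "Re (ntrace (mat_adjoint X * X)) \<le> C" if "X \<in> {A, B}" for X
    using 0(3)[of X] that As by auto
  have nn: "0 \<le> Re (ntrace (mat_adjoint X * X))" if "X \<in> {A, B}" for X
    using that A B by (auto simp: ntrace_adjoint_mult_self[of _ N] intro!: divide_nonneg_nonneg sum_nonneg)
  from nn[of A] le[of A] have "0 \<le> C" by simp
  \<comment> \<open>For two factors the claim is Cauchy-Schwarz: a geometric mean does not exceed
    the larger of its terms.\<close>
  have "(cmod (ntrace (A * B)))\<^sup>2 \<le> C * C"
    using le nn \<open>0 \<le> C\<close> by (intro order_trans[OF ntrace_Cauchy_Schwarz[OF A B]] mult_mono) auto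
  then have "cmod (ntrace (A * B)) \<le> C"
    using \<open>0 \<le> C\<close> by (simp add: power2_le_imp_le power2_eq_square[of C])
  then show ?case using A B by (simp add: As)
next
  case (Suc k)
  have even: "even (length As)" by (simp add: Suc)
  have pair: "Re (ntrace ((mat_adjoint X * X) ^\<^sub>m (2 ^ k))) \<le> C" if X: "X \<in> set (pair_products As)" for X
  proof -
    from set_pair_products[OF X] obtain A B where AB: "A \<in> set As" "B \<in> set As" "X = A * B" by auto
    have A: "A \<in> carrier_mat N N" and B: "B \<in> carrier_mat N N" using AB Suc.prems(2) by auto
    define P Q where "P = mat_adjoint A * A" and "Q = B * mat_adjoint B"
    have P: "P \<in> carrier_mat N N" and Q: "Q \<in> carrier_mat N N" using A B by (auto simp: P_def Q_def)
    have adj: "mat_adjoint P = P" "mat_adjoint Q = Q"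
      using A B unfolding P_def Q_def
      by (auto simp: mat_adjoint_mult[of _ N N _ N] mat_adjoint_adjoint)
    have "mat_adjoint X * X = mat_adjoint B * (P * B)"
      using A B by (simp add: AB P_def mat_adjoint_mult[of _ N N _ N] assoc_mult_mat[of _ N N _ N _ N])
    then have "ntrace ((mat_adjoint X * X) ^\<^sub>m (2 ^ k)) = ntrace ((P * B * mat_adjoint B) ^\<^sub>m (2 ^ k))"
      using P B by (simp add: ntrace_pow_mult_commute[of _ N])
    also have "P * B * mat_adjoint B = P * Q"
      using P B by (simp add: Q_def assoc_mult_mat[of _ N N _ N _ N])
    also have "(P * Q) ^\<^sub>m (2 ^ k) = mat_prod_list N (concat (replicate (2 ^ k) [P, Q]))"
      by (simp add: mat_prod_list_alternating[OF P Q])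
    also have "cmod (ntrace \<dots>) \<le> C"
    proof (rule Suc.IH)
      show "length (concat (replicate (2 ^ k) [P, Q])) = 2 ^ Suc k"
        by (simp add: length_concat sum_list_replicate)
      show "set (concat (replicate (2 ^ k) [P, Q])) \<subseteq> carrier_mat N N" using P Q by auto
      fix Y assume "Y \<in> set (concat (replicate (2 ^ k) [P, Q]))"
      then have Y: "Y = P \<or> Y = Q" by (auto simp: set_replicate_conv_if split: if_splits)
      \<comment> \<open>The hypothesis speaks of \<open>mat_adjoint B * B\<close>, while
        \<open>Q\<close> has the factors in the other order; their power traces agree.\<close>
      have "ntrace (Q ^\<^sub>m (2 ^ Suc k)) = ntrace ((mat_adjoint B * B) ^\<^sub>m (2 ^ Suc k))"
        unfolding Q_def using B by (intro ntrace_pow_mult_commute[of _ N]) auto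
      then have "Re (ntrace (Y ^\<^sub>m (2 ^ Suc k))) \<le> C"
        using Y Suc.prems(3)[OF AB(1)] Suc.prems(3)[OF AB(2)] by (auto simp: P_def simp del: pow_mat.simps)
      \<comment> \<open>Since \<open>Y\<close> is Hermitian, the quantity demanded one level below
        is the trace of its power of order \<open>2 ^ Suc k\<close>, exactly what is bounded at the
        present level.\<close>
      moreover have "mat_adjoint Y * Y = Y * Y" "Y \<in> carrier_mat N N" using Y adj P Q by auto
      ultimately show "Re (ntrace ((mat_adjoint Y * Y) ^\<^sub>m (2 ^ k))) \<le> C"
        by (simp add: pow_mat_square)
    qed
    finally have "cmod (ntrace ((mat_adjoint X * X) ^\<^sub>m (2 ^ k))) \<le> C" .
    then show ?thesis using complex_Re_le_cmod order_trans by blast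
  qed
  have "cmod (ntrace (mat_prod_list N (pair_products As))) \<le> C"
  proof (rule Suc.IH[OF _ _ pair])
    show "set (pair_products As) \<subseteq> carrier_mat N N"
      using Suc.prems(2) by (fastforce dest: set_pair_products intro!: mult_carrier_mat)
  qed (auto simp: length_pair_products Suc.prems)
  then show ?case by (simp add: mat_prod_list_pair_products[OF Suc.prems(2) even])
qed

text \<open>Identity matrices pad the word to length \<open>2 ^ Suc k\<close>, the length required
  by the halving argument. For positive \<open>N\<close> their powers have normalized trace 1,
  whence the lower bound on \<open>C\<close>.\<close>

lemma ntrace_hermitian_word_le:
  assumes len: "length As \<le> 2 ^ Suc k" and C: "1 \<le> C"
    and As: "set As \<subseteq> carrier_mat N N"
    and herm: "\<And>A. A \<in> set As \<Longrightarrow> mat_adjoint A = A"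
    and le: "\<And>A. A \<in> set As \<Longrightarrow> Re (ntrace (A ^\<^sub>m (2 ^ Suc k))) \<le> C"
  shows "cmod (ntrace (mat_prod_list N As)) \<le> C"
proof (cases "N = 0")
  case True
  then have "ntrace (mat_prod_list N As) = 0"
    using As by (subst ntrace_sum[of _ N]) auto
  then show ?thesis using C by simp
next
  case False
  let ?I = "replicate (2 ^ Suc k - length As) (1\<^sub>m N)"
  have "mat_prod_list N (As @ ?I) = mat_prod_list N As"
  proof -
    have "1\<^sub>m N ^\<^sub>m m = (1\<^sub>m N :: complex mat)" for m by (induction m) auto
    then have "mat_prod_list N ?I = 1\<^sub>m N" by (subst mat_prod_list_replicate) auto
    then show ?thesis
      using As right_mult_one_mat[OF mat_prod_list_carrier[OF As]]
      by (subst mat_prod_list_append) (auto simp: set_replicate_conv_if)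
  qed
  moreover have "cmod (ntrace (mat_prod_list N (As @ ?I))) \<le> C"
  proof (rule ntrace_prod_le_max[where k = k])
    show "length (As @ ?I) = 2 ^ Suc k" using len by simp
    show "set (As @ ?I) \<subseteq> carrier_mat N N" using As by (auto simp: set_replicate_conv_if)
    fix A assume A: "A \<in> set (As @ ?I)"
    have one: "1\<^sub>m N ^\<^sub>m m = (1\<^sub>m N :: complex mat)" for m by (induction m) auto
    show "Re (ntrace ((mat_adjoint A * A) ^\<^sub>m (2 ^ k))) \<le> C"
    proof (cases "A \<in> set As")
      case True
      then have "A \<in> carrier_mat N N" using As by auto
      then show ?thesis using le[OF True] herm[OF True] by (simp add: pow_mat_square del: pow_mat.simps)
    next
      case nA: False
      then have "A = 1\<^sub>m N" using A by (auto simp: set_replicate_conv_if split: if_splits)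
      then show ?thesis using C \<open>N \<noteq> 0\<close> by (simp add: mat_adjoint_one one ntrace_one)
    qed
  qed
  ultimately show ?thesis by simp
qed

text \<open>Cauchy-Schwarz against the identity matrix.\<close>

lemma norm_ntrace_le:
  assumes A: "A \<in> carrier_mat N N"
  shows "(cmod (ntrace A))\<^sup>2 \<le> Re (ntrace (mat_adjoint A * A))"
proof (cases "N = 0")
  case True
  then show ?thesis using A by (auto simp: ntrace_def mtrace_def)
next
  case False
  then show ?thesis
    using ntrace_Cauchy_Schwarz[OF A one_carrier_mat] A
    by (simp add: mat_adjoint_one ntrace_one)
qed

section \<open>Kronecker products\<close>

lemma mat_conj_carrier [simp]: "A \<in> carrier_mat m n \<Longrightarrow> mat_conj A \<in> carrier_mat m n"
  by (auto simp: mat_conj_def)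

lemma dim_mat_conj [simp]: "dim_row (mat_conj A) = dim_row A" "dim_col (mat_conj A) = dim_col A"
  by (auto simp: mat_conj_def)

lemma index_mat_conj: "i < dim_row A \<Longrightarrow> j < dim_col A \<Longrightarrow> mat_conj A $$ (i, j) = cnj (A $$ (i, j))"
  by (simp add: mat_conj_def)

lemma mat_conj_one: "mat_conj (1\<^sub>m N) = 1\<^sub>m N"
  by (rule eq_matI) (auto simp: index_mat_conj)

lemma mat_conj_mult:
  assumes A: "A \<in> carrier_mat l m" and B: "B \<in> carrier_mat m n"
  shows "mat_conj (A * B) = mat_conj A * mat_conj B"
proof (rule eq_matI)
  fix i j assume "i < dim_row (mat_conj A * mat_conj B)" "j < dim_col (mat_conj A * mat_conj B)"
  then have ij: "i < l" "j < n" using A B by auto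
  have "mat_conj (A * B) $$ (i, j) = cnj ((A * B) $$ (i, j))"
    using A B ij by (intro index_mat_conj) auto
  also have "\<dots> = (\<Sum>k<m. mat_conj A $$ (i, k) * mat_conj B $$ (k, j))"
    using A B ij by (subst index_mult_mat_sum[OF A B]) (auto simp: index_mat_conj)
  also have "\<dots> = (mat_conj A * mat_conj B) $$ (i, j)"
    using A B ij by (subst index_mult_mat_sum[of _ l m _ n]) auto
  finally show "mat_conj (A * B) $$ (i, j) = (mat_conj A * mat_conj B) $$ (i, j)" .
qed (use A B in auto)

lemma ntrace_mat_conj: "A \<in> carrier_mat N N \<Longrightarrow> ntrace (mat_conj A) = cnj (ntrace A)"
  by (subst (1 2) ntrace_sum[of _ N]) (auto simp: index_mat_conj)

lemma mat_adjoint_conj: "mat_adjoint (mat_conj A) = mat_conj (mat_adjoint A)"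
  by (rule eq_matI) (auto simp: index_mat_conj index_mat_adjoint)

lemma kron_carrier [simp]:
  "A \<in> carrier_mat m n \<Longrightarrow> B \<in> carrier_mat p q \<Longrightarrow> kron A B \<in> carrier_mat (m * p) (n * q)"
  by (auto simp: kron_def)

lemma dim_kron [simp]:
  "dim_row (kron A B) = dim_row A * dim_row B" "dim_col (kron A B) = dim_col A * dim_col B"
  by (auto simp: kron_def)

lemma index_kron:
  "i < dim_row A * dim_row B \<Longrightarrow> j < dim_col A * dim_col B \<Longrightarrow>
    kron A B $$ (i, j) = A $$ (i div dim_row B, j div dim_col B) * B $$ (i mod dim_row B, j mod dim_col B)"
  by (simp add: kron_def)

lemma div_mod_less_mult:
  assumes "i < m * n"
  shows "i div n < m" "i mod n < (n :: nat)"
proof -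
  have "0 < n" using assms by (cases n) auto
  then show "i div n < m" "i mod n < n" using assms by (auto simp: less_mult_imp_div_less)
qed

text \<open>Quotient and remainder by \<open>n\<close> are the two coordinates under which
  \<open>kron\<close> stores an entry, so a sum over a tensor index splits into independent
  sums.\<close>

lemma sum_div_mod:
  fixes f :: "nat \<Rightarrow> nat \<Rightarrow> 'c :: comm_monoid_add"
  shows "(\<Sum>k<m * n. f (k div n) (k mod n)) = (\<Sum>i<m. \<Sum>j<n. f i j)"
  unfolding sum.cartesian_product
proof (rule sum.reindex_bij_witness[where i = "\<lambda>(i, j). i * n + j" and j = "\<lambda>k. (k div n, k mod n)"])
  fix b :: "nat \<times> nat" assume "b \<in> {..<m} \<times> {..<n}"
  then obtain i j where b: "b = (i, j)" "i < m" "j < n" by auto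
  have "i * n + j < Suc i * n" using b by simp
  also have "\<dots> \<le> m * n" using b by (intro mult_le_mono) auto
  finally show "(case b of (i, j) \<Rightarrow> i * n + j) \<in> {..<m * n}" using b by simp
qed (auto simp: div_mod_less_mult)

lemma kron_mult:
  assumes A: "A \<in> carrier_mat l m" and C: "C \<in> carrier_mat m n"
    and B: "B \<in> carrier_mat p q" and D: "D \<in> carrier_mat q r"
  shows "kron A B * kron C D = kron (A * C) (B * D)"
proof (rule eq_matI)
  fix i j assume "i < dim_row (kron (A * C) (B * D))" "j < dim_col (kron (A * C) (B * D))"
  then have ij: "i < l * p" "j < n * r" using A B C D by auto
  note less = div_mod_less_mult[OF ij(1)] div_mod_less_mult[OF ij(2)]
  have "(kron A B * kron C D) $$ (i, j) = (\<Sum>k<m * q. kron A B $$ (i, k) * kron C D $$ (k, j))"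
    using A B C D ij by (intro index_mult_mat_sum) auto
  also have "\<dots> = (\<Sum>k<m * q. A $$ (i div p, k div q) * B $$ (i mod p, k mod q)
      * (C $$ (k div q, j div r) * D $$ (k mod q, j mod r)))"
    using A B C D ij by (intro sum.cong refl) (auto simp: index_kron)
  also have "\<dots> = (\<Sum>s<m. \<Sum>t<q. A $$ (i div p, s) * B $$ (i mod p, t) * (C $$ (s, j div r) * D $$ (t, j mod r)))"
    by (rule sum_div_mod)
  also have "\<dots> = (\<Sum>s<m. A $$ (i div p, s) * C $$ (s, j div r)) * (\<Sum>t<q. B $$ (i mod p, t) * D $$ (t, j mod r))"
    by (simp add: sum_product mult_ac)
  also have "\<dots> = (A * C) $$ (i div p, j div r) * (B * D) $$ (i mod p, j mod r)"
    using less by (subst (1 2) index_mult_mat_sum) (use A B C D in auto)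
  also have "\<dots> = kron (A * C) (B * D) $$ (i, j)"
    using A B C D ij by (subst index_kron) auto
  finally show "(kron A B * kron C D) $$ (i, j) = kron (A * C) (B * D) $$ (i, j)" .
qed (use A B C D in auto)

lemma kron_one: "kron (1\<^sub>m m) (1\<^sub>m n) = 1\<^sub>m (m * n)"
proof (rule eq_matI)
  fix i j assume "i < dim_row (1\<^sub>m (m * n) :: complex mat)" "j < dim_col (1\<^sub>m (m * n) :: complex mat)"
  then have ij: "i < m * n" "j < m * n" by auto
  have "i = j \<longleftrightarrow> i div n = j div n \<and> i mod n = j mod n"
    by (metis div_mult_mod_eq)
  then show "kron (1\<^sub>m m) (1\<^sub>m n) $$ (i, j) = 1\<^sub>m (m * n) $$ (i, j)"
    using ij div_mod_less_mult[OF ij(1)] div_mod_less_mult[OF ij(2)] by (auto simp: index_kron)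
qed auto

lemma mat_adjoint_kron: "mat_adjoint (kron A B) = kron (mat_adjoint A) (mat_adjoint B)"
  by (rule eq_matI) (auto simp: index_kron index_mat_adjoint div_mod_less_mult)

lemma ntrace_kron:
  assumes A: "A \<in> carrier_mat m m" and B: "B \<in> carrier_mat n n"
  shows "ntrace (kron A B) = ntrace A * ntrace B"
proof -
  have "ntrace (kron A B) = (\<Sum>k<m * n. A $$ (k div n, k div n) * B $$ (k mod n, k mod n)) / of_nat (m * n)"
    using A B by (subst ntrace_sum[of _ "m * n"]) (auto simp: index_kron)
  also have "\<dots> = (\<Sum>i<m. \<Sum>j<n. A $$ (i, i) * B $$ (j, j)) / of_nat (m * n)"
    by (subst sum_div_mod) simp
  also have "\<dots> = ntrace A * ntrace B"
    by (simp add: ntrace_sum[OF A] ntrace_sum[OF B] sum_product)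
  finally show ?thesis .
qed

text \<open>The mixed product rule, applied letter by letter, keeps a word in Kronecker squares a
  Kronecker square; its trace is then a number times its own conjugate.\<close>

lemma mat_prod_list_kron_conj:
  "set As \<subseteq> carrier_mat N N \<Longrightarrow>
    mat_prod_list (N * N) (map (\<lambda>A. kron A (mat_conj A)) As)
      = kron (mat_prod_list N As) (mat_conj (mat_prod_list N As))"
  by (induction As)
    (auto simp: kron_one mat_conj_one kron_mult[of _ N N _ N _ N N _ N] mat_conj_mult[of _ N N _ N])

lemma ntrace_word_kron_conj:
  assumes "set As \<subseteq> carrier_mat N N"
  shows "ntrace (mat_prod_list (N * N) (map (\<lambda>A. kron A (mat_conj A)) As))
    = of_real ((cmod (ntrace (mat_prod_list N As)))\<^sup>2)"
  using assms
  by (simp add: mat_prod_list_kron_conj ntrace_kron[of _ N _ N] ntrace_mat_conj[of _ N]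
      complex_norm_square del: of_real_power)

section \<open>Spectra of Hermitian matrices\<close>

text \<open>For an eigenvector v, the quadratic form of \<open>A\<close> at v is z times the squared
  length of v, and it is its own conjugate because \<open>A\<close> is Hermitian.\<close>

lemma hermitian_char_poly_root_real:
  assumes A: "A \<in> carrier_mat N N" and herm: "mat_adjoint A = A" and root: "poly (char_poly A) z = 0"
  shows "Im z = 0"
proof -
  from root have "eigenvalue A z" by (simp add: eigenvalue_root_char_poly[OF A])
  then obtain v where v: "v \<in> carrier_vec N" "v \<noteq> 0\<^sub>v N" "A *\<^sub>v v = z \<cdot>\<^sub>v v"
    using A unfolding eigenvalue_def eigenvector_def by auto
  define S where "S = (\<Sum>i<N. (cmod (v $ i))\<^sup>2)"
  define Q where "Q = (\<Sum>i<N. \<Sum>j<N. cnj (v $ i) * A $$ (i, j) * v $ j)"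
  have "Q = (\<Sum>i<N. cnj (v $ i) * (A *\<^sub>v v) $ i)"
    using A v(1) by (auto simp: Q_def scalar_prod_def lessThan_atLeast0 sum_distrib_left mult.assoc
        intro!: sum.cong)
  also have "\<dots> = z * of_real S"
    using v(1) unfolding v(3)
    by (auto simp: S_def sum_distrib_left complex_norm_square mult_ac simp del: of_real_power intro!: sum.cong)
  finally have Q: "Q = z * of_real S" .
  have "cnj Q = (\<Sum>i<N. \<Sum>j<N. v $ i * cnj (A $$ (i, j)) * cnj (v $ j))"
    by (simp add: Q_def)
  also have "\<dots> = (\<Sum>i<N. \<Sum>j<N. v $ i * A $$ (j, i) * cnj (v $ j))"
  proof (intro sum.cong refl)
    fix i j assume "i \<in> {..<N}" "j \<in> {..<N}"
    then have "A $$ (j, i) = cnj (A $$ (i, j))"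
      using A index_mat_adjoint[of j A i] by (auto simp: herm)
    then show "v $ i * cnj (A $$ (i, j)) * cnj (v $ j) = v $ i * A $$ (j, i) * cnj (v $ j)" by simp
  qed
  also have "\<dots> = Q"
    unfolding Q_def by (subst sum.swap) (simp add: mult_ac)
  finally have "Im Q = 0" by (simp add: complex_eq_iff)
  moreover have "S \<noteq> 0"
  proof
    assume "S = 0"
    then have "v $ i = 0" if "i < N" for i
      using that by (auto simp: S_def sum_nonneg_eq_0_iff)
    then have "v = 0\<^sub>v N" using v(1) by (intro eq_vecI) auto
    with v(2) show False by simp
  qed
  ultimately show ?thesis by (simp add: Q)
qed

text \<open>The diagonal entry of the next power is computed from the vanishing below the diagonal
  at the preceding exponent, so both claims share one induction.\<close>

lemma upper_triangular_pow:
  fixes B :: "complex mat"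
  assumes B: "B \<in> carrier_mat N N" and ut: "upper_triangular B"
  shows "i < N \<Longrightarrow> j < i \<Longrightarrow> (B ^\<^sub>m p) $$ (i, j) = 0"
    and "i < N \<Longrightarrow> (B ^\<^sub>m p) $$ (i, i) = (B $$ (i, i)) ^ p"
proof (induction p arbitrary: i j)
  case (Suc p)
  have zero: "B $$ (i, j) = 0" if "j < i" "i < N" for i j
    using that ut B by (auto dest: upper_triangularD)
  have prod: "(B ^\<^sub>m Suc p) $$ (i, j) = (\<Sum>k<N. (B ^\<^sub>m p) $$ (i, k) * B $$ (k, j))"
    if "i < N" "j < N" for i j
    using B that unfolding pow_mat.simps by (intro index_mult_mat_sum) auto
  {
    case 1
    have "(B ^\<^sub>m p) $$ (i, k) * B $$ (k, j) = 0" if "k < N" for k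
      using Suc.IH(1)[of i k] zero[of j k] that 1 by (cases "k < i") auto
    then have "(\<Sum>k<N. (B ^\<^sub>m p) $$ (i, k) * B $$ (k, j)) = 0" by (intro sum.neutral) auto
    then show ?case using 1 by (simp add: prod del: pow_mat.simps)
  next
    case 2
    have "(B ^\<^sub>m p) $$ (i, k) * B $$ (k, i) = (if k = i then (B $$ (i, i)) ^ p * B $$ (i, i) else 0)"
      if "k < N" for k
      using Suc.IH(1)[of i k] Suc.IH(2)[of i] zero[of i k] that 2 by (cases "k < i") auto
    then have "(\<Sum>k<N. (B ^\<^sub>m p) $$ (i, k) * B $$ (k, i))
        = (\<Sum>k<N. if k = i then (B $$ (i, i)) ^ p * B $$ (i, i) else 0)"
      by (intro sum.cong) auto
    then show ?case using 2 by (simp add: prod del: pow_mat.simps)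
  }
qed (use B in auto)

text \<open>A Schur triangularization suffices: similarity preserves the traces of powers, and for a
  triangular matrix these see only the diagonal, which consists of roots of the characteristic
  polynomial. One family \<open>e\<close> serves all exponents, as a spectral measure
  requires.\<close>

lemma hermitian_ntrace_pow:
  assumes A: "A \<in> carrier_mat N N" and herm: "mat_adjoint A = A"
  shows "\<exists>e :: nat \<Rightarrow> real. \<forall>p. ntrace (A ^\<^sub>m p) = of_real ((\<Sum>i<N. e i ^ p) / real N)"
proof -
  obtain as where as: "char_poly A = (\<Prod>a\<leftarrow>as. [:- a, 1:])" "length as = N"
    using char_poly_factorized[OF A] by blast
  obtain B P Q where "schur_decomposition A as = (B, P, Q)" by (cases "schur_decomposition A as") auto
  from schur_decomposition[OF A as(1) this]
  have wit: "similar_mat_wit A B P Q" and ut: "upper_triangular B" and diag: "diag_mat B = as" by auto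
  from similar_mat_witD2[OF A wit]
  have carr: "B \<in> carrier_mat N N" "P \<in> carrier_mat N N" "Q \<in> carrier_mat N N" and QP: "Q * P = 1\<^sub>m N"
    by auto
  have real: "B $$ (i, i) = of_real (Re (B $$ (i, i)))" if "i < N" for i
  proof -
    have "B $$ (i, i) \<in> set as" using that carr diag by (auto simp: diag_mat_def)
    then have "poly (char_poly A) (B $$ (i, i)) = 0"
      by (auto simp: as(1) poly_prod_list prod_list_zero_iff)
    from hermitian_char_poly_root_real[OF A herm this] show ?thesis by (simp add: complex_eq_iff)
  qed
  have "ntrace (A ^\<^sub>m p) = of_real ((\<Sum>i<N. Re (B $$ (i, i)) ^ p) / real N)" for p
  proof -
    have "ntrace (A ^\<^sub>m p) = ntrace (P * (B ^\<^sub>m p * Q))"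
      using carr by (simp add: similar_mat_wit_pow_id[OF wit] assoc_mult_mat[of _ N N _ N _ N])
    also have "\<dots> = ntrace (B ^\<^sub>m p * Q * P)"
      using carr by (intro ntrace_mult_commute[of _ N]) auto
    also have "\<dots> = ntrace (B ^\<^sub>m p)"
      using carr by (simp add: assoc_mult_mat[of _ N N _ N _ N] QP right_mult_one_mat[of _ N N])
    also have "\<dots> = (\<Sum>i<N. (B $$ (i, i)) ^ p) / of_nat N"
      using carr by (subst ntrace_sum[of _ N]) (auto simp: upper_triangular_pow(2)[OF carr(1) ut])
    also have "(\<Sum>i<N. (B $$ (i, i)) ^ p) = of_real (\<Sum>i<N. Re (B $$ (i, i)) ^ p)"
      unfolding of_real_sum of_real_power using real by (intro sum.cong) auto
    finally show ?thesis by simp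
  qed
  then show ?thesis by (intro exI[of _ "\<lambda>i. Re (B $$ (i, i))"]) blast
qed

section \<open>Convergence in probability and in expectation\<close>

text \<open>Convergence in probability along a sequence of probability spaces is convergence along a single
  filter on pairs (index, outcome), so the limit theorems for filters apply to it.\<close>
definition prob_filter :: "(nat \<Rightarrow> 'a measure) \<Rightarrow> (nat \<times> 'a) filter" where
  "prob_filter M = Abs_filter (\<lambda>P. \<exists>A. (\<forall>n. A n \<in> sets (M n)) \<and>
     (\<lambda>n. measure (M n) (A n)) \<longlonglongrightarrow> 0 \<and> (\<forall>n. \<forall>\<omega>\<in>space (M n) - A n. P (n, \<omega>)))"

text \<open>Closure under conjunction is the union bound for the exceptional sets.\<close>

lemma eventually_prob_filter:
  "eventually P (prob_filter M) \<longleftrightarrow> (\<exists>A. (\<forall>n. A n \<in> sets (M n)) \<and>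
     (\<lambda>n. measure (M n) (A n)) \<longlonglongrightarrow> 0 \<and> (\<forall>n. \<forall>\<omega>\<in>space (M n) - A n. P (n, \<omega>)))"
  unfolding prob_filter_def
proof (rule eventually_Abs_filter, rule is_filter.intro)
  show "\<exists>A. (\<forall>n. A n \<in> sets (M n)) \<and> (\<lambda>n. measure (M n) (A n)) \<longlonglongrightarrow> 0 \<and>
      (\<forall>n. \<forall>\<omega>\<in>space (M n) - A n. True)"
    by (intro exI[of _ "\<lambda>_. {}"]) auto
next
  fix P Q
  assume "\<exists>A. (\<forall>n. A n \<in> sets (M n)) \<and> (\<lambda>n. measure (M n) (A n)) \<longlonglongrightarrow> 0 \<and>
      (\<forall>n. \<forall>\<omega>\<in>space (M n) - A n. P (n, \<omega>))"
    and "\<exists>A. (\<forall>n. A n \<in> sets (M n)) \<and> (\<lambda>n. measure (M n) (A n)) \<longlonglongrightarrow> 0 \<and>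
      (\<forall>n. \<forall>\<omega>\<in>space (M n) - A n. Q (n, \<omega>))"
  then obtain A B where A: "\<And>n. A n \<in> sets (M n)" "(\<lambda>n. measure (M n) (A n)) \<longlonglongrightarrow> 0"
      "\<And>n \<omega>. \<omega> \<in> space (M n) - A n \<Longrightarrow> P (n, \<omega>)"
    and B: "\<And>n. B n \<in> sets (M n)" "(\<lambda>n. measure (M n) (B n)) \<longlonglongrightarrow> 0"
      "\<And>n \<omega>. \<omega> \<in> space (M n) - B n \<Longrightarrow> Q (n, \<omega>)"
    by blast
  have "(\<lambda>n. measure (M n) (A n \<union> B n)) \<longlonglongrightarrow> 0"
  proof (rule tendsto_sandwich[OF _ _ tendsto_const])
    show "(\<lambda>n. measure (M n) (A n) + measure (M n) (B n)) \<longlonglongrightarrow> 0"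
      using tendsto_add[OF A(2) B(2)] by simp
    show "\<forall>\<^sub>F n in sequentially. measure (M n) (A n \<union> B n) \<le> measure (M n) (A n) + measure (M n) (B n)"
      by (intro always_eventually allI measure_Un_le A(1) B(1))
  qed auto
  with A B show "\<exists>A. (\<forall>n. A n \<in> sets (M n)) \<and> (\<lambda>n. measure (M n) (A n)) \<longlonglongrightarrow> 0 \<and>
      (\<forall>n. \<forall>\<omega>\<in>space (M n) - A n. P (n, \<omega>) \<and> Q (n, \<omega>))"
    by (intro exI[of _ "\<lambda>n. A n \<union> B n"]) auto
next
  fix P Q assume "\<forall>x. P x \<longrightarrow> Q x"
    "\<exists>A. (\<forall>n. A n \<in> sets (M n)) \<and> (\<lambda>n. measure (M n) (A n)) \<longlonglongrightarrow> 0 \<and>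
      (\<forall>n. \<forall>\<omega>\<in>space (M n) - A n. P (n, \<omega>))"
  then show "\<exists>A. (\<forall>n. A n \<in> sets (M n)) \<and> (\<lambda>n. measure (M n) (A n)) \<longlonglongrightarrow> 0 \<and>
      (\<forall>n. \<forall>\<omega>\<in>space (M n) - A n. Q (n, \<omega>))"
    by blast
qed

lemma eventually_prob_filter_space: "\<forall>\<^sub>F x in prob_filter M. snd x \<in> space (M (fst x))"
  unfolding eventually_prob_filter by (intro exI[of _ "\<lambda>_. {}"]) auto

lemma eventually_prob_filter_fst:
  assumes "eventually P sequentially"
  shows "\<forall>\<^sub>F x in prob_filter M. P (fst x)"
proof -
  from assms obtain N where N: "\<And>n. N \<le> n \<Longrightarrow> P n" by (auto simp: eventually_sequentially)
  \<comment> \<open>Finitely many indices are discarded by declaring the whole space exceptional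
    there.\<close>
  let ?A = "\<lambda>n. if n < N then space (M n) else {}"
  have "\<forall>\<^sub>F n in sequentially. measure (M n) (?A n) = 0"
    using eventually_ge_at_top[of N] by eventually_elim auto
  then have "(\<lambda>n. measure (M n) (?A n)) \<longlonglongrightarrow> 0" by (rule tendsto_eventually)
  then show ?thesis
    unfolding eventually_prob_filter using N by (intro exI[of _ ?A]) (auto split: if_splits)
qed

lemma tendsto_prob_filter_fst:
  fixes f :: "nat \<Rightarrow> 'b :: topological_space"
  assumes "f \<longlonglongrightarrow> c"
  shows "((\<lambda>x. f (fst x)) \<longlongrightarrow> c) (prob_filter M)"
  using assms unfolding tendsto_def by (auto intro: eventually_prob_filter_fst)

text \<open>An exceptional set of probability below 1 is not the whole space. This is the passage
  from random matrices to a single deterministic matrix when the limit measure is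
  constructed.\<close>

lemma eventually_prob_filter_ex:
  assumes prob: "\<And>n. prob_space (M n)" and "eventually P (prob_filter M)"
  shows "\<exists>n. \<exists>\<omega>\<in>space (M n). P (n, \<omega>)"
proof -
  from assms(2) obtain A where A: "\<And>n. A n \<in> sets (M n)" "(\<lambda>n. measure (M n) (A n)) \<longlonglongrightarrow> 0"
      "\<And>n \<omega>. \<omega> \<in> space (M n) - A n \<Longrightarrow> P (n, \<omega>)"
    unfolding eventually_prob_filter by auto
  from order_tendstoD(2)[OF A(2), of 1] obtain n where n: "measure (M n) (A n) < 1"
    by (auto simp: eventually_sequentially)
  have "A n \<noteq> space (M n)" using n prob_space.prob_space[OF prob, of n] by auto
  with sets.sets_into_space[OF A(1)] show ?thesis using A(3) by blast
qed

lemma conv_in_prob_imp_tendsto: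
  assumes "conv_in_prob M Y c"
  shows "((\<lambda>x. Y (fst x) (snd x)) \<longlongrightarrow> c) (prob_filter M)"
proof (rule tendstoI)
  fix e :: real assume e: "0 < e"
  have meas: "Y n \<in> borel_measurable (M n)" for n using assms by (auto simp: conv_in_prob_def)
  \<comment> \<open>Off the event the deviation satisfies a non-strict bound only; half the
    tolerance makes it strict.\<close>
  have "{\<omega> \<in> space (M n). e / 2 < cmod (Y n \<omega> - c)} \<in> sets (M n)" for n
    using meas[of n] by measurable
  moreover have "(\<lambda>n. measure (M n) {\<omega> \<in> space (M n). e / 2 < cmod (Y n \<omega> - c)}) \<longlonglongrightarrow> 0"
    using assms half_gt_zero[OF e] unfolding conv_in_prob_def by blast
  ultimately show "\<forall>\<^sub>F x in prob_filter M. dist (Y (fst x) (snd x)) c < e"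
    unfolding eventually_prob_filter using e
    by (intro exI[of _ "\<lambda>n. {\<omega> \<in> space (M n). e / 2 < cmod (Y n \<omega> - c)}"]) (auto simp: dist_norm)
qed

lemma tendsto_imp_conv_in_prob:
  fixes M :: "nat \<Rightarrow> 'a measure"
  assumes prob: "\<And>n. prob_space (M n)" and meas: "\<And>n. Y n \<in> borel_measurable (M n)"
    and lim: "((\<lambda>x. Y (fst x) (snd x)) \<longlongrightarrow> c) (prob_filter M)"
  shows "conv_in_prob M Y c"
  unfolding conv_in_prob_def
proof (intro conjI allI impI meas)
  fix e :: real assume "0 < e"
  from tendstoD[OF lim this] obtain A where A: "\<And>n. A n \<in> sets (M n)"
      "(\<lambda>n. measure (M n) (A n)) \<longlonglongrightarrow> 0"
      "\<And>n \<omega>. \<omega> \<in> space (M n) - A n \<Longrightarrow> dist (Y n \<omega>) c < e"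
    unfolding eventually_prob_filter by auto
  have "measure (M n) {\<omega> \<in> space (M n). e < cmod (Y n \<omega> - c)} \<le> measure (M n) (A n)" for n
  proof -
    interpret prob_space "M n" by (rule prob)
    show ?thesis using A(1)[of n] A(3)[of _ n] by (intro finite_measure_mono) (force simp: dist_norm)+
  qed
  then show "(\<lambda>n. measure (M n) {\<omega> \<in> space (M n). e < cmod (Y n \<omega> - c)}) \<longlonglongrightarrow> 0"
    by (intro tendsto_sandwich[OF _ _ tendsto_const A(2)]) auto
qed

text \<open>Boundedness in \<open>L\<^sup>2\<close> gives uniform integrability, which upgrades convergence in probability.\<close>
lemma conv_in_exp_of_square_dominated:
  assumes prob: "\<And>n. prob_space (M n)" and meas: "\<And>n. Y n \<in> borel_measurable (M n)"
    and dom: "\<And>n \<omega>. \<omega> \<in> space (M n) \<Longrightarrow> (cmod (Y n \<omega>))\<^sup>2 \<le> C n \<omega>"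
    and int: "\<And>n. integrable (M n) (C n)" and bound: "\<And>n. (\<integral>\<omega>. C n \<omega> \<partial>M n) \<le> B"
    and conv: "conv_in_prob M Y c"
  shows "conv_in_exp M Y c"
proof -
  \<comment> \<open>An upper bound for twice the mean of \<open>C n\<close> plus twice the squared
    modulus of \<open>c\<close>, hence for the second moment of the deviation. The summand 1 makes
    it positive, as it becomes a denominator.\<close>
  define K where "K = 2 * \<bar>B\<bar> + 2 * (cmod c)\<^sup>2 + 1"
  have K: "0 < K" unfolding K_def by (simp add: add_nonneg_pos)
  have le_square: "x \<le> 1 + x\<^sup>2" for x :: real
    using sum_power2_ge_zero[of "x - 1 / 2" 0] by (auto simp: power2_eq_square algebra_simps)
  have integrable_Y: "integrable (M n) (Y n)" for n
  proof -
    interpret prob_space "M n" by (rule prob)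
    show ?thesis
    proof (rule Bochner_Integration.integrable_bound)
      show "integrable (M n) (\<lambda>\<omega>. 1 + C n \<omega>)" using int by auto
      show "AE \<omega> in M n. norm (Y n \<omega>) \<le> norm (1 + C n \<omega>)"
      proof (intro AE_I2)
        fix \<omega> assume "\<omega> \<in> space (M n)"
        then show "norm (Y n \<omega>) \<le> norm (1 + C n \<omega>)"
          using dom[of \<omega> n] le_square[of "cmod (Y n \<omega>)"] by (simp add: abs_if)
      qed
    qed (rule meas)
  qed
  have dist_square: "(cmod (Y n \<omega> - c))\<^sup>2 \<le> 2 * C n \<omega> + 2 * (cmod c)\<^sup>2" if "\<omega> \<in> space (M n)" for n \<omega>
  proof -
    have "(cmod (Y n \<omega> - c))\<^sup>2 \<le> (cmod (Y n \<omega>) + cmod c)\<^sup>2"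
      by (intro power_mono norm_triangle_ineq4) auto
    also have "\<dots> \<le> 2 * (cmod (Y n \<omega>))\<^sup>2 + 2 * (cmod c)\<^sup>2"
      using zero_le_power2[of "cmod (Y n \<omega>) - cmod c"] by (simp add: power2_eq_square algebra_simps)
    finally show ?thesis using dom[OF that] by simp
  qed
  have "(\<lambda>n. \<integral>\<omega>. Y n \<omega> \<partial>M n) \<longlonglongrightarrow> c"
  proof (rule tendstoI)
    fix e :: real assume e: "0 < e"
    \<comment> \<open>Makes the second-moment term contribute at most
      \<open>\<delta> * K = e / 3\<close>; the other two thirds are reserved for small deviations
      and for the exceptional event.\<close>
    define \<delta> where "\<delta> = e / (3 * K)"
    have \<delta>: "0 < \<delta>" using e K by (simp add: \<delta>_def)
    define A where "A n = {\<omega> \<in> space (M n). e / 3 < cmod (Y n \<omega> - c)}" for n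
    have A: "A n \<in> sets (M n)" for n unfolding A_def using meas[of n] by measurable
    have e3: "0 < e / 3" using e by simp
    have "(\<lambda>n. measure (M n) (A n)) \<longlonglongrightarrow> 0"
      using conv e3 unfolding A_def conv_in_prob_def by blast
    from order_tendstoD(2)[OF this, of "\<delta> * (e / 3)"] \<delta> e
    have "\<forall>\<^sub>F n in sequentially. measure (M n) (A n) < \<delta> * (e / 3)" by simp
    then show "\<forall>\<^sub>F n in sequentially. dist (\<integral>\<omega>. Y n \<omega> \<partial>M n) c < e"
    proof eventually_elim
      case (elim n)
      interpret prob_space "M n" by (rule prob)
      have ind: "integrable (M n) (indicat_real (A n))"
        using A[of n] by (intro integrable_real_indicator) (auto simp: less_top[symmetric])
      have ind_eq: "(\<integral>\<omega>. indicat_real (A n) \<omega> \<partial>M n) = measure (M n) (A n)"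
        using A[of n] by (simp add: Int_absorb2 sets.sets_into_space)
      \<comment> \<open>On the exceptional event the deviation D is at most \<delta> D^2 + 1 /
        \<delta>, a rescaling of x \<le> 1 + x^2; elsewhere it is at most e / 3. The sum of these
        bounds is one integrable majorant.\<close>
      have pointwise: "cmod (Y n \<omega> - c)
          \<le> e / 3 + \<delta> * (2 * C n \<omega> + 2 * (cmod c)\<^sup>2) + indicator (A n) \<omega> / \<delta>"
        if \<omega>: "\<omega> \<in> space (M n)" for \<omega>
      proof -
        define D where "D = cmod (Y n \<omega> - c)"
        have sq: "0 \<le> \<delta> * D\<^sup>2" "\<delta> * D\<^sup>2 \<le> \<delta> * (2 * C n \<omega> + 2 * (cmod c)\<^sup>2)"
          using dist_square[OF \<omega>] \<delta> by (auto simp: D_def)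
        show ?thesis
        proof (cases "\<omega> \<in> A n")
          case True
          have "\<delta> * D \<le> 1 + (\<delta> * D)\<^sup>2" by (rule le_square)
          then have "\<delta> * D \<le> \<delta> * (\<delta> * D\<^sup>2 + 1 / \<delta>)"
            using \<delta> by (simp add: algebra_simps power2_eq_square)
          then have "D \<le> \<delta> * D\<^sup>2 + 1 / \<delta>" using \<delta> by (simp only: mult_le_cancel_left_pos)
          then show ?thesis using sq e True by (simp flip: D_def)
        next
          case False
          then have "D \<le> e / 3" using \<omega> by (auto simp: A_def D_def)
          then show ?thesis using sq False by (simp flip: D_def)
        qed
      qed
      have "cmod ((\<integral>\<omega>. Y n \<omega> \<partial>M n) - c) = cmod (\<integral>\<omega>. Y n \<omega> - c \<partial>M n)"
        using integrable_Y[of n] by (simp add: prob_space)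
      also have "\<dots> \<le> (\<integral>\<omega>. cmod (Y n \<omega> - c) \<partial>M n)" by (rule integral_norm_bound)
      also have "\<dots> \<le> (\<integral>\<omega>. e / 3 + \<delta> * (2 * C n \<omega> + 2 * (cmod c)\<^sup>2) + indicator (A n) \<omega> / \<delta> \<partial>M n)"
      proof (rule integral_mono)
        show "integrable (M n)
            (\<lambda>\<omega>. e / 3 + \<delta> * (2 * C n \<omega> + 2 * (cmod c)\<^sup>2) + indicator (A n) \<omega> / \<delta>)"
          using int[of n] ind by auto
      qed (use integrable_Y[of n] pointwise in auto)
      also have "\<dots> = e / 3 + \<delta> * (2 * (\<integral>\<omega>. C n \<omega> \<partial>M n) + 2 * (cmod c)\<^sup>2) + measure (M n) (A n) / \<delta>"
        using int[of n] ind by (simp add: prob_space ind_eq del: Bochner_Integration.integral_indicator)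
      also have "\<dots> < e / 3 + \<delta> * K + e / 3"
      proof -
        have "2 * (\<integral>\<omega>. C n \<omega> \<partial>M n) + 2 * (cmod c)\<^sup>2 \<le> K" using bound[of n] by (simp add: K_def)
        then have "\<delta> * (2 * (\<integral>\<omega>. C n \<omega> \<partial>M n) + 2 * (cmod c)\<^sup>2) \<le> \<delta> * K" using \<delta> by simp
        moreover have "measure (M n) (A n) / \<delta> < e / 3" using elim \<delta> by (simp add: field_simps)
        ultimately show ?thesis by linarith
      qed
      also have "\<dots> = e" using K by (simp add: \<delta>_def)
      finally show ?case by (simp add: dist_norm)
    qed
  qed
  with integrable_Y show ?thesis by (simp add: conv_in_exp_def)
qed

section \<open>Measurability of random matrices and their traces\<close>

definition mat_measurable :: "'a measure \<Rightarrow> nat \<Rightarrow> ('a \<Rightarrow> complex mat) \<Rightarrow> bool" where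
  "mat_measurable M N A \<longleftrightarrow> (\<forall>\<omega>\<in>space M. A \<omega> \<in> carrier_mat N N) \<and>
     (\<forall>i<N. \<forall>j<N. (\<lambda>\<omega>. A \<omega> $$ (i, j)) \<in> borel_measurable M)"

lemma mat_measurable_index:
  "mat_measurable M N A \<Longrightarrow> i < N \<Longrightarrow> j < N \<Longrightarrow> (\<lambda>\<omega>. A \<omega> $$ (i, j)) \<in> borel_measurable M"
  by (simp add: mat_measurable_def)

lemma mat_measurable_const: "A \<in> carrier_mat N N \<Longrightarrow> mat_measurable M N (\<lambda>_. A)"
  by (simp add: mat_measurable_def)

lemma mat_measurable_mult:
  assumes "mat_measurable M N A" "mat_measurable M N B"
  shows "mat_measurable M N (\<lambda>\<omega>. A \<omega> * B \<omega>)"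
  unfolding mat_measurable_def
proof (intro conjI ballI allI impI)
  fix i j assume ij: "i < N" "j < N"
  have "(\<lambda>\<omega>. \<Sum>k<N. A \<omega> $$ (i, k) * B \<omega> $$ (k, j)) \<in> borel_measurable M"
    using assms ij by (intro borel_measurable_sum borel_measurable_times mat_measurable_index) auto
  moreover have "(A \<omega> * B \<omega>) $$ (i, j) = (\<Sum>k<N. A \<omega> $$ (i, k) * B \<omega> $$ (k, j))"
    if "\<omega> \<in> space M" for \<omega>
    using assms that ij by (intro index_mult_mat_sum) (auto simp: mat_measurable_def)
  ultimately show "(\<lambda>\<omega>. (A \<omega> * B \<omega>) $$ (i, j)) \<in> borel_measurable M"
    by (simp cong: measurable_cong del: index_mult_mat)
qed (use assms in \<open>auto simp: mat_measurable_def intro: mult_carrier_mat\<close>)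

lemma mat_measurable_kron_conj:
  assumes "mat_measurable M N A"
  shows "mat_measurable M (N * N) (\<lambda>\<omega>. kron (A \<omega>) (mat_conj (A \<omega>)))"
  unfolding mat_measurable_def
proof (intro conjI ballI allI impI)
  fix i j assume ij: "i < N * N" "j < N * N"
  note less = div_mod_less_mult[OF ij(1)] div_mod_less_mult[OF ij(2)]
  have "(\<lambda>\<omega>. A \<omega> $$ (i div N, j div N) * cnj (A \<omega> $$ (i mod N, j mod N))) \<in> borel_measurable M"
    using assms less
    by (intro borel_measurable_times borel_measurable_continuous_on[OF continuous_on_cnj[OF continuous_on_id]])
      (auto simp: mat_measurable_def)
  moreover have "kron (A \<omega>) (mat_conj (A \<omega>)) $$ (i, j)
      = A \<omega> $$ (i div N, j div N) * cnj (A \<omega> $$ (i mod N, j mod N))" if "\<omega> \<in> space M" for \<omega>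
  proof -
    have "A \<omega> \<in> carrier_mat N N" using assms that by (auto simp: mat_measurable_def)
    then show ?thesis using ij less by (auto simp: index_kron index_mat_conj)
  qed
  ultimately show "(\<lambda>\<omega>. kron (A \<omega>) (mat_conj (A \<omega>)) $$ (i, j)) \<in> borel_measurable M"
    by (simp cong: measurable_cong)
qed (use assms in \<open>auto simp: mat_measurable_def\<close>)

lemma mat_sum_carrier [simp]: "mat_sum N f I \<in> carrier_mat N N"
  by (simp add: mat_sum_def)

lemma mat_measurable_prod_list:
  assumes "\<And>A. A \<in> set As \<Longrightarrow> mat_measurable M N A"
  shows "mat_measurable M N (\<lambda>\<omega>. mat_prod_list N (map (\<lambda>A. A \<omega>) As))"
  using assms by (induction As) (auto intro: mat_measurable_const mat_measurable_mult)

lemma borel_measurable_ntrace: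
  assumes "mat_measurable M N A"
  shows "(\<lambda>\<omega>. ntrace (A \<omega>)) \<in> borel_measurable M"
proof -
  have "(\<lambda>\<omega>. (\<Sum>i<N. A \<omega> $$ (i, i)) / of_nat N) \<in> borel_measurable M"
    using assms
    by (intro borel_measurable_divide borel_measurable_sum mat_measurable_index borel_measurable_const) auto
  moreover have "ntrace (A \<omega>) = (\<Sum>i<N. A \<omega> $$ (i, i)) / of_nat N" if "\<omega> \<in> space M" for \<omega>
    using assms that by (intro ntrace_sum) (auto simp: mat_measurable_def)
  ultimately show ?thesis by (simp cong: measurable_cong)
qed

section \<open>Limits of moment sequences\<close>

text \<open>Truncation turns powers into bounded continuous functions, the test functions to which
  weak convergence applies.\<close>

definition clamp_real :: "real \<Rightarrow> real \<Rightarrow> real" where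
  "clamp_real R x = max (- R) (min R x)"

lemma clamp_real_power_bound: "0 \<le> R \<Longrightarrow> \<bar>clamp_real R x ^ p\<bar> \<le> R ^ p"
  unfolding power_abs by (intro power_mono) (auto simp: clamp_real_def)

text \<open>Beyond the threshold R \<le> R^p \<le> |x|^p, so |x|^p is at most x^(2p) / R, and both
  the power and its truncation are bounded by |x|^p. The truncation error is thus controlled by an
  even moment, uniformly over measures.\<close>

lemma clamp_real_power_diff:
  assumes R: "1 \<le> R" and p: "1 \<le> p"
  shows "\<bar>x ^ p - clamp_real R x ^ p\<bar> \<le> 2 * (x ^ (2 * p) / R)"
proof (cases "\<bar>x\<bar> \<le> R")
  case True
  then have "clamp_real R x = x" by (auto simp: clamp_real_def)
  then show ?thesis using R by simp
next
  case False
  have clamp: "\<bar>clamp_real R x\<bar> \<le> \<bar>x\<bar>" using False R by (auto simp: clamp_real_def)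
  have "\<bar>x ^ p - clamp_real R x ^ p\<bar> \<le> \<bar>x\<bar> ^ p + \<bar>clamp_real R x\<bar> ^ p"
    using abs_triangle_ineq4[of "x ^ p" "clamp_real R x ^ p"] by (simp add: power_abs)
  also have "\<dots> \<le> \<bar>x\<bar> ^ p + \<bar>x\<bar> ^ p" using clamp by (intro add_mono power_mono) auto
  also have "\<dots> \<le> 2 * (x ^ (2 * p) / R)"
  proof -
    have "R \<le> R ^ p" using power_increasing[OF p R] by simp
    also have "\<dots> \<le> \<bar>x\<bar> ^ p" using False R by (intro power_mono) auto
    finally have "R * \<bar>x\<bar> ^ p \<le> \<bar>x\<bar> ^ p * \<bar>x\<bar> ^ p" by (intro mult_right_mono) auto
    also have "\<dots> = x ^ (2 * p)"
      by (simp add: power_abs[symmetric] power_mult power2_eq_square mult_2 power_add flip: abs_mult)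
    finally show ?thesis using R by (simp add: field_simps)
  qed
  finally show ?thesis .
qed

text \<open>Bounded second moments give tightness and hence a weakly convergent subsequence. Weak
  convergence sees bounded functions only, so a moment is transferred by truncation, with an error
  controlled by the moment of twice its order. Convergence of moments along the full sequence
  identifies those of the subsequential limit.\<close>

lemma moments_of_limit:
  fixes \<mu> :: "nat \<Rightarrow> real measure" and m :: "nat \<Rightarrow> real"
  assumes dist: "\<And>n. real_distribution (\<mu> n)"
    and int: "\<And>n p. integrable (\<mu> n) (\<lambda>x. x ^ p)"
    and lim: "\<And>p. (\<lambda>n. \<integral>x. x ^ p \<partial>\<mu> n) \<longlonglongrightarrow> m p"
  shows "\<exists>\<nu>. moment_measure \<nu> \<and> (\<forall>p. (\<integral>x. x ^ p \<partial>\<nu>) = m p)"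
proof -
  have "\<exists>B>0. \<forall>n. \<bar>\<integral>x. x ^ (2 * p) \<partial>\<mu> n\<bar> \<le> B" for p
    using convergent_imp_Bseq[OF convergentI[OF lim[of "2 * p"]]] by (auto simp: Bseq_def)
  then obtain B where B: "\<And>p. 0 < B p" "\<And>p n. \<bar>\<integral>x. x ^ (2 * p) \<partial>\<mu> n\<bar> \<le> B p" by metis
  have "tight \<mu>"
    unfolding tight_def
  proof (intro conjI allI impI dist)
    fix e :: real assume e: "0 < e"
    \<comment> \<open>Chebyshev's inequality bounds the mass outside the interval by B 1 / R^2,
      hence by B 1 / R once \<open>R\<close> is at least 1; this choice makes the latter smaller
      than \<open>e\<close>.\<close>
    define R where "R = 1 + B 1 / e"
    have R: "1 \<le> R" "B 1 / R < e" using B(1)[of 1] e by (auto simp: R_def field_simps)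
    show "\<exists>a b. a < b \<and> (\<forall>n. 1 - e < measure (\<mu> n) {a<..b})"
    proof (intro exI conjI allI)
      show "- R < R" using R by simp
      fix n
      interpret real_distribution "\<mu> n" by (rule dist)
      have "measure (\<mu> n) {x \<in> space (\<mu> n). R\<^sup>2 \<le> x\<^sup>2} \<le> (\<integral>x. x\<^sup>2 \<partial>\<mu> n) / R\<^sup>2"
        using int[of n 2] R by (intro integral_Markov_inequality_measure[of _ _ "{}"]) auto
      also have "\<dots> \<le> B 1 / R\<^sup>2" using B(2)[where p = 1 and n = n] R by (intro divide_right_mono) auto
      also have "\<dots> \<le> B 1 / R"
        using R B(1)[of 1] by (intro divide_left_mono) (auto simp: power2_eq_square)
      also have "\<dots> < e" by (rule R)
      finally have "measure (\<mu> n) {x. R\<^sup>2 \<le> x\<^sup>2} < e" by simp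
      moreover have "measure (\<mu> n) (UNIV - {- R<..R}) \<le> measure (\<mu> n) {x. R\<^sup>2 \<le> x\<^sup>2}"
        using R by (intro finite_measure_mono) (auto simp: abs_le_square_iff[symmetric])
      moreover have "measure (\<mu> n) (UNIV - {- R<..R}) = 1 - measure (\<mu> n) {- R<..R}"
        using prob_compl[of "{- R<..R}"] by simp
      ultimately show "1 - e < measure (\<mu> n) {- R<..R}" by linarith
    qed
  qed
  from tight_imp_convergent_subsubsequence[OF this strict_mono_id]
  obtain r \<nu> where r: "strict_mono (r :: nat \<Rightarrow> nat)" and \<nu>: "real_distribution \<nu>"
    and weak: "weak_conv_m (\<mu> \<circ> r) \<nu>" by (auto simp: o_def id_def)
  interpret \<nu>: real_distribution \<nu> by (rule \<nu>)
  have conv: "(\<lambda>n. \<integral>x. f x \<partial>\<mu> (r n)) \<longlonglongrightarrow> (\<integral>x. f x \<partial>\<nu>)"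
    if "\<And>x. isCont f x" "\<And>x. \<bar>f x\<bar> \<le> C" for f :: "real \<Rightarrow> real" and C
    using weak_conv_imp_integral_bdd_continuous_conv[OF _ \<nu> weak, of f C] dist that by (simp add: o_def)
  have even_moment: "integrable \<nu> (\<lambda>x. x ^ (2 * p)) \<and> (\<integral>x. x ^ (2 * p) \<partial>\<nu>) \<le> B p" for p
  proof -
    \<comment> \<open>Capped powers are bounded and continuous, so their integrals inherit the bound
      \<open>B p\<close>; monotone convergence in the cap then yields the moment itself.\<close>
    let ?f = "\<lambda>k x. min (x ^ (2 * p)) (real k)"
    have nn: "0 \<le> x ^ (2 * p)" for x :: real by (simp add: power_mult)
    have int_f: "integrable \<nu> (?f k)" for k
      by (rule \<nu>.integrable_const_bound[of _ "real k"]) (auto simp: nn abs_le_iff min_le_iff_disj)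
    have le: "(\<integral>x. ?f k x \<partial>\<nu>) \<le> B p" for k
    proof (rule LIMSEQ_le_const2)
      show "(\<lambda>n. \<integral>x. ?f k x \<partial>\<mu> (r n)) \<longlonglongrightarrow> (\<integral>x. ?f k x \<partial>\<nu>)"
        by (rule conv[of _ "real k"]) (auto simp: nn abs_le_iff min_le_iff_disj intro!: continuous_intros)
      have "(\<integral>x. ?f k x \<partial>\<mu> (r n)) \<le> B p" for n
      proof -
        interpret real_distribution "\<mu> (r n)" by (rule dist)
        have "(\<integral>x. ?f k x \<partial>\<mu> (r n)) \<le> (\<integral>x. x ^ (2 * p) \<partial>\<mu> (r n))"
          by (intro integral_mono int integrable_const_bound[of _ "real k"])
            (auto simp: nn abs_le_iff min_le_iff_disj)
        then show ?thesis using B(2)[where p = p and n = "r n"] by linarith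
      qed
      then show "\<exists>N. \<forall>n\<ge>N. (\<integral>x. ?f k x \<partial>\<mu> (r n)) \<le> B p" by blast
    qed
    have inc: "incseq (\<lambda>k. \<integral>x. ?f k x \<partial>\<nu>)"
      by (intro incseq_SucI integral_mono int_f) auto
    then obtain L where L: "(\<lambda>k. \<integral>x. ?f k x \<partial>\<nu>) \<longlonglongrightarrow> L"
      using le incseq_convergent by metis
    have ptw: "(\<lambda>k. ?f k x) \<longlonglongrightarrow> x ^ (2 * p)" for x
    proof (rule tendsto_eventually)
      obtain k0 where "x ^ (2 * p) \<le> real k0" using real_arch_simple by blast
      then show "\<forall>\<^sub>F k in sequentially. ?f k x = x ^ (2 * p)"
        by (intro eventually_sequentiallyI[of k0]) (auto simp: min_def)
    qed
    have mono: "AE x in \<nu>. mono (\<lambda>k. ?f k x)" by (auto simp: mono_def)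
    have "integrable \<nu> (\<lambda>x. x ^ (2 * p))" "(\<integral>x. x ^ (2 * p) \<partial>\<nu>) = L"
      using ptw by (auto intro!: integrable_monotone_convergence[OF int_f mono _ L]
          integral_monotone_convergence[OF int_f mono _ L])
    moreover have "L \<le> B p" using le by (intro LIMSEQ_le_const2[OF L]) auto
    ultimately show ?thesis by simp
  qed
  have int_\<nu>: "integrable \<nu> (\<lambda>x. x ^ p)" for p
  proof (rule Bochner_Integration.integrable_bound)
    show "integrable \<nu> (\<lambda>x. 1 + x ^ (2 * p))" using even_moment[of p] by auto
    \<comment> \<open>This elementary inequality reduces integrability of odd powers to that of even
      ones.\<close>
    have "\<bar>y\<bar> \<le> 1 + y\<^sup>2" for y :: real
      using zero_le_power2[of "\<bar>y\<bar> - 1 / 2"] by (simp add: power2_eq_square algebra_simps flip: abs_mult)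
    then have "\<bar>x ^ p\<bar> \<le> 1 + x ^ (2 * p)" for x :: real
      by (metis power_mult power_commutes mult.commute)
    then show "AE x in \<nu>. norm (x ^ p) \<le> norm (1 + x ^ (2 * p))"
      by (intro AE_I2) (metis abs_ge_self order_trans real_norm_def)
  qed simp
  have "(\<integral>x. x ^ p \<partial>\<nu>) = m p" for p
  proof (cases "p = 0")
    case True
    have "(\<integral>x. x ^ 0 \<partial>\<mu> n) = 1" for n
    proof -
      interpret real_distribution "\<mu> n" by (rule dist)
      show ?thesis using prob_space by simp
    qed
    then have "m 0 = 1" using lim[of 0] by (simp add: LIMSEQ_const_iff)
    then show ?thesis using True \<nu>.prob_space by simp
  next
    case False
    \<comment> \<open>Two errors of size \<open>2 * B p / R\<close> meet at the truncated integral
      of \<nu>: one from \<nu> itself, one inherited from the sequence in the limit. Letting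
      \<open>R\<close> grow removes both.\<close>
    have near: "\<bar>(\<integral>x. x ^ p \<partial>\<nu>) - m p\<bar> \<le> 4 * B p / R" if R: "1 \<le> R" for R
    proof -
      let ?g = "\<lambda>x. clamp_real R x ^ p"
      have cont: "isCont ?g x" for x
        unfolding clamp_real_def by (intro continuous_intros)
      have bound: "\<bar>?g x\<bar> \<le> R ^ p" for x using R by (intro clamp_real_power_bound) auto
      have meas: "?g \<in> borel_measurable borel"
        by (intro borel_measurable_continuous_onI continuous_at_imp_continuous_on) (use cont in auto)
      have diff: "\<bar>(\<integral>x. x ^ p \<partial>\<rho>) - (\<integral>x. ?g x \<partial>\<rho>)\<bar> \<le> 2 * B p / R"
        if \<rho>: "real_distribution \<rho>" "\<And>q. integrable \<rho> (\<lambda>x. x ^ q)" "(\<integral>x. x ^ (2 * p) \<partial>\<rho>) \<le> B p" for \<rho>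
      proof -
        interpret real_distribution \<rho> by (rule \<rho>)
        have g: "integrable \<rho> ?g"
          using meas bound by (intro integrable_const_bound[of _ "R ^ p"]) auto
        have "\<bar>(\<integral>x. x ^ p \<partial>\<rho>) - (\<integral>x. ?g x \<partial>\<rho>)\<bar> = \<bar>\<integral>x. x ^ p - ?g x \<partial>\<rho>\<bar>"
          using \<rho>(2) g by simp
        also have "\<dots> \<le> (\<integral>x. \<bar>x ^ p - ?g x\<bar> \<partial>\<rho>)" by (rule integral_abs_bound)
        also have "\<dots> \<le> (\<integral>x. 2 * (x ^ (2 * p) / R) \<partial>\<rho>)"
          using \<rho>(2) g R False by (intro integral_mono clamp_real_power_diff) auto
        also have "\<dots> = 2 * (\<integral>x. x ^ (2 * p) \<partial>\<rho>) / R" by simp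
        also have "\<dots> \<le> 2 * B p / R" using \<rho>(3) R by (intro divide_right_mono) auto
        finally show ?thesis .
      qed
      have "(\<lambda>n. \<bar>(\<integral>x. x ^ p \<partial>\<mu> (r n)) - (\<integral>x. ?g x \<partial>\<mu> (r n))\<bar>) \<longlonglongrightarrow> \<bar>m p - (\<integral>x. ?g x \<partial>\<nu>)\<bar>"
        using LIMSEQ_subseq_LIMSEQ[OF lim r, of p] conv[OF cont bound]
        by (intro tendsto_intros) (auto simp: o_def)
      then have "\<bar>m p - (\<integral>x. ?g x \<partial>\<nu>)\<bar> \<le> 2 * B p / R"
      proof (rule LIMSEQ_le_const2)
        have "(\<integral>x. x ^ (2 * p) \<partial>\<mu> n) \<le> B p" for n using B(2)[where p = p and n = n] by linarith
        then show "\<exists>N. \<forall>n\<ge>N. \<bar>(\<integral>x. x ^ p \<partial>\<mu> (r n)) - (\<integral>x. ?g x \<partial>\<mu> (r n))\<bar> \<le> 2 * B p / R"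
          using diff[OF dist int] by blast
      qed
      with diff[OF \<nu> int_\<nu>] even_moment[of p] show ?thesis by (simp add: abs_le_iff)
    qed
    have "(\<lambda>k. 4 * B p / real (Suc k)) \<longlonglongrightarrow> 0"
      using tendsto_mult_right_zero[OF LIMSEQ_inverse_real_of_nat, of "4 * B p"]
      by (simp add: field_simps inverse_eq_divide)
    then have "\<bar>(\<integral>x. x ^ p \<partial>\<nu>) - m p\<bar> \<le> 0"
      using near[of "real (Suc _)"] by (intro LIMSEQ_le_const) auto
    then show ?thesis by simp
  qed
  with \<nu> int_\<nu> show ?thesis unfolding moment_measure_def by blast
qed

text \<open>The empirical eigenvalue distribution, built as the image of the uniform measure on the
  \<open>N\<close> indices.\<close>

lemma hermitian_spectral_distribution:
  assumes A: "A \<in> carrier_mat N N" and herm: "mat_adjoint A = A" and N: "0 < N"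
  shows "\<exists>\<rho>. real_distribution \<rho> \<and> (\<forall>p. integrable \<rho> (\<lambda>x. x ^ p) \<and>
    ntrace (A ^\<^sub>m p) = complex_of_real (\<integral>x. x ^ p \<partial>\<rho>))"
proof -
  obtain e :: "nat \<Rightarrow> real" where e: "\<And>p. ntrace (A ^\<^sub>m p) = of_real ((\<Sum>i<N. e i ^ p) / real N)"
    using hermitian_ntrace_pow[OF A herm] by blast
  define U where "U = uniform_count_measure {..<N}"
  interpret U: prob_space U
    unfolding U_def using N by (intro prob_space_uniform_count_measure) auto
  have sets_U: "sets U = sets (count_space {..<N})" by (simp add: U_def sets_uniform_count_measure)
  have meas: "f \<in> borel_measurable U" for f :: "nat \<Rightarrow> real"
    by (simp add: measurable_cong_sets[OF sets_U refl])
  let ?\<rho> = "distr U borel e"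
  have "integrable ?\<rho> (\<lambda>x. x ^ p)" for p
  proof -
    have "integrable U (\<lambda>i. e i ^ p)"
      by (rule U.integrable_const_bound[of _ "\<Sum>i<N. \<bar>e i ^ p\<bar>"])
        (auto simp: U_def space_uniform_count_measure meas[unfolded U_def] intro!: AE_I2 member_le_sum)
    then show ?thesis by (simp add: integrable_distr_eq meas)
  qed
  moreover have "(\<integral>x. x ^ p \<partial>?\<rho>) = (\<Sum>i<N. e i ^ p) / real N" for p
    using meas[of e] by (simp add: integral_distr) (simp add: U_def integral_uniform_count_measure)
  ultimately show ?thesis
    using U.real_distribution_distr[OF meas] e by (intro exI[of _ ?\<rho>]) auto
qed

text \<open>At a single outcome only finitely many moments can be guaranteed to be close to their
  limits. The k-th matrix takes care of orders up to k, so every fixed moment is eventually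
  approximated along the sequence.\<close>

lemma hermitian_moment_limit:
  fixes m :: "nat \<Rightarrow> real"
  assumes "\<And>k :: nat. \<exists>N A. 0 < N \<and> A \<in> carrier_mat N N \<and> mat_adjoint A = A \<and>
    (\<forall>p\<le>k. cmod (ntrace (A ^\<^sub>m p) - of_real (m p)) < 1 / real (Suc k))"
  shows "\<exists>\<nu>. moment_measure \<nu> \<and> (\<forall>p. (\<integral>x. x ^ p \<partial>\<nu>) = m p)"
proof -
  have "\<exists>\<rho>. real_distribution \<rho> \<and> (\<forall>p. integrable \<rho> (\<lambda>x. x ^ p)) \<and>
      (\<forall>p\<le>k. \<bar>(\<integral>x. x ^ p \<partial>\<rho>) - m p\<bar> < 1 / real (Suc k))" for k
  proof -
    obtain N A where A: "0 < N" "A \<in> carrier_mat N N" "mat_adjoint A = A"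
      "\<And>p. p \<le> k \<Longrightarrow> cmod (ntrace (A ^\<^sub>m p) - of_real (m p)) < 1 / real (Suc k)"
      using assms by metis
    obtain \<rho> where \<rho>: "real_distribution \<rho>" "\<And>p. integrable \<rho> (\<lambda>x. x ^ p)"
      "\<And>p. ntrace (A ^\<^sub>m p) = complex_of_real (\<integral>x. x ^ p \<partial>\<rho>)"
      using hermitian_spectral_distribution[OF A(2,3,1)] by blast
    have "\<bar>(\<integral>x. x ^ p \<partial>\<rho>) - m p\<bar> < 1 / real (Suc k)" if "p \<le> k" for p
      using A(4)[OF that] unfolding \<rho>(3) of_real_diff[symmetric] norm_of_real .
    with \<rho> show ?thesis by blast
  qed
  then obtain \<rho> where \<rho>: "\<And>k. real_distribution (\<rho> k)" "\<And>k p. integrable (\<rho> k) (\<lambda>x. x ^ p)"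
    "\<And>k p. p \<le> k \<Longrightarrow> \<bar>(\<integral>x. x ^ p \<partial>\<rho> k) - m p\<bar> < 1 / real (Suc k)"
    by metis
  show ?thesis
  proof (rule moments_of_limit[OF \<rho>(1,2)])
    fix p
    have "(\<lambda>k. (\<integral>x. x ^ p \<partial>\<rho> k) - m p) \<longlonglongrightarrow> 0"
    proof (rule Lim_null_comparison)
      show "\<forall>\<^sub>F k in sequentially. norm ((\<integral>x. x ^ p \<partial>\<rho> k) - m p) \<le> 1 / real (Suc k)"
        using \<rho>(3)[of p] by (intro eventually_sequentiallyI[of p]) (auto intro: less_imp_le simp del: of_nat_Suc)
      show "(\<lambda>k. 1 / real (Suc k)) \<longlonglongrightarrow> 0"
        using LIMSEQ_inverse_real_of_nat by (simp add: inverse_eq_divide)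
    qed
    then show "(\<lambda>k. \<integral>x. x ^ p \<partial>\<rho> k) \<longlonglongrightarrow> m p" by (simp add: LIM_zero_iff)
  qed
qed

section \<open>Asymptotic freeness\<close>

text \<open>Recentering one factor changes the trace by a multiple of a shorter word only, which
  drives the induction on the length.\<close>

lemma ntrace_prod_list_shift:
  assumes As: "set As \<subseteq> carrier_mat N N" and Bs: "set Bs \<subseteq> carrier_mat N N" and X: "X \<in> carrier_mat N N"
  shows "ntrace (mat_prod_list N (As @ (X - c \<cdot>\<^sub>m 1\<^sub>m N) # Bs))
    = ntrace (mat_prod_list N (As @ X # Bs)) - c * ntrace (mat_prod_list N (As @ Bs))"
proof -
  let ?P = "mat_prod_list N As" and ?Q = "mat_prod_list N Bs"
  have PQ: "?P \<in> carrier_mat N N" "?Q \<in> carrier_mat N N" using As Bs by auto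
  have c1: "c \<cdot>\<^sub>m 1\<^sub>m N \<in> carrier_mat N N" by auto
  then have diff: "X - c \<cdot>\<^sub>m 1\<^sub>m N \<in> carrier_mat N N" by (rule minus_carrier_mat)
  have "?P * ((X - c \<cdot>\<^sub>m 1\<^sub>m N) * ?Q) = ?P * (X * ?Q - c \<cdot>\<^sub>m ?Q)"
    using PQ X by (simp add: minus_mult_distrib_mat[OF X c1 PQ(2)] mult_smult_assoc_mat[of _ N N _ N]
        left_mult_one_mat[of _ N N])
  also have "\<dots> = ?P * (X * ?Q) - c \<cdot>\<^sub>m (?P * ?Q)"
    using PQ X by (simp add: mult_minus_distrib_mat[of _ N N _ N] mult_smult_distrib[of _ N N _ N])
  finally show ?thesis
    using As Bs X PQ diff by (simp add: mat_prod_list_append ntrace_diff[of _ N] ntrace_smult[of _ N]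
        mult_carrier_mat[of _ N N _ N])
qed

lemma minus_zero_smult_one: "A \<in> carrier_mat n n \<Longrightarrow> A - 0 \<cdot>\<^sub>m 1\<^sub>m n = A" for A :: "complex mat"
  by (rule eq_matI) auto

lemma nc_prob_spaceD:
  assumes "nc_prob_space sc star \<tau>"
  shows "sc 1 x = x" and "sc (s + t) x = sc s x + sc t x"
    and "sc t (x * y) = sc t x * y" and "sc t (x * y) = x * sc t y"
    and "\<tau> (x + y) = \<tau> x + \<tau> y" and "\<tau> (sc t x) = t * \<tau> x" and "\<tau> 1 = 1"
proof -
  note 1 = assms[unfolded nc_prob_space_def]
  note 2 = 1[THEN conjunct2, THEN conjunct2]
  note 3 = 2[THEN conjunct2, THEN conjunct2]
  note 4 = 3[THEN conjunct2, THEN conjunct2, THEN conjunct2, THEN conjunct2, THEN conjunct2]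
  show "sc 1 x = x" by (rule 1[THEN conjunct1, rule_format])
  show "sc (s + t) x = sc s x + sc t x" by (rule 2[THEN conjunct1, rule_format])
  show "sc t (x * y) = sc t x * y" by (rule 3[THEN conjunct1, rule_format, THEN conjunct1])
  show "sc t (x * y) = x * sc t y" by (rule 3[THEN conjunct1, rule_format, THEN conjunct2])
  show "\<tau> (x + y) = \<tau> x + \<tau> y" by (rule 4[THEN conjunct1, rule_format])
  show "\<tau> (sc t x) = t * \<tau> x" by (rule 4[THEN conjunct2, THEN conjunct1, rule_format])
  show "\<tau> 1 = 1" by (rule 4[THEN conjunct2, THEN conjunct2, THEN conjunct1])
qed

lemma sc_zero:
  assumes "nc_prob_space sc star \<tau>"
  shows "sc 0 x = 0"
  using nc_prob_spaceD(2)[OF assms, of 0 0 x] by simp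

lemma tau_diff:
  assumes "nc_prob_space sc star \<tau>"
  shows "\<tau> (x - y) = \<tau> x - \<tau> y"
  using nc_prob_spaceD(5)[OF assms, of "x - y" y] by simp

lemma free_centered_prod_list:
  fixes sc :: "complex \<Rightarrow> 'b::ring_1 \<Rightarrow> 'b"
  assumes ncps: "nc_prob_space sc star \<tau>" and free: "free_vars sc \<tau> I a"
    and "l \<noteq> []" "fst ` set l \<subseteq> I" "\<And>k. Suc k < length l \<Longrightarrow> fst (l ! k) \<noteq> fst (l ! Suc k)"
  shows "\<tau> (prod_list (map (\<lambda>(i, p). a i ^ p - sc (\<tau> (a i ^ p)) 1) l)) = 0"
proof -
  note add = nc_prob_spaceD(2)[OF ncps] and one = nc_prob_spaceD(1)[OF ncps] and zero = sc_zero[OF ncps]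
  have uminus: "sc (- t) x = - sc t x" for t x
    using add[of t "- t" x] by (simp add: zero eq_neg_iff_add_eq_0 add.commute)
  have gen: "a i ^ p - sc t 1 \<in> alg_gen sc (a i)" for i p t
  proof -
    \<comment> \<open>Coefficient 1 at degree \<open>p\<close> and \<open>- t\<close> at degree 0.
      They are added rather than selected by cases, so that both contribute when
      \<open>p = 0\<close>.\<close>
    let ?c = "\<lambda>k. (if k = p then 1 else 0) + (if k = 0 then - t else 0)"
    have "(\<Sum>k\<le>p. sc (?c k) (a i ^ k))
        = (\<Sum>k\<le>p. sc (if k = p then 1 else 0) (a i ^ k)) + (\<Sum>k\<le>p. sc (if k = 0 then - t else 0) (a i ^ k))"
      by (simp only: add sum.distrib)
    also have "(\<Sum>k\<le>p. sc (if k = p then 1 else 0) (a i ^ k)) = (\<Sum>k\<le>p. if k = p then a i ^ p else 0)"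
      by (intro sum.cong refl) (simp add: one zero)
    also have "(\<Sum>k\<le>p. sc (if k = 0 then - t else 0) (a i ^ k)) = (\<Sum>k\<le>p. if k = 0 then - sc t 1 else 0)"
      by (intro sum.cong refl) (simp add: uminus zero)
    finally have "a i ^ p - sc t 1 = (\<Sum>k\<le>p. sc (?c k) (a i ^ k))" by simp
    then show ?thesis unfolding alg_gen_def mem_Collect_eq by (intro exI[of _ ?c] exI[of _ p])
  qed
  let ?xs = "map (\<lambda>(i, p). a i ^ p - sc (\<tau> (a i ^ p)) 1) l"
  have "?xs \<noteq> [] \<and> length (map fst l) = length ?xs \<and> set (map fst l) \<subseteq> I \<and>
     (\<forall>k<length ?xs. ?xs ! k \<in> alg_gen sc (a (map fst l ! k)) \<and> \<tau> (?xs ! k) = 0) \<and>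
     (\<forall>k. Suc k < length (map fst l) \<longrightarrow> map fst l ! k \<noteq> map fst l ! Suc k)"
    using assms(3-5) by (auto simp: case_prod_unfold gen tau_diff[OF ncps] nc_prob_spaceD(6,7)[OF ncps])
  then show ?thesis using free unfolding free_vars_def by blast
qed

text \<open>Induction on the length of a word in powers, each carrying a flag that says whether it is
  centered. Changing a flag costs a shorter word, so all flags may be chosen freely: centered if the word
  is alternating, where freeness applies, and uncentered otherwise, where the word can be shortened.\<close>
lemma tendsto_ntrace_word:
  fixes M :: "nat \<Rightarrow> 'a measure" and sc :: "complex \<Rightarrow> 'b::ring_1 \<Rightarrow> 'b"
  assumes carrier: "\<And>n i \<omega>. i < d \<Longrightarrow> \<omega> \<in> space (M n) \<Longrightarrow> W n i \<omega> \<in> carrier_mat n n"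
    and conv: "\<And>i. i < d \<Longrightarrow> weak_conv_prob M (\<lambda>n. W n i) (\<mu> i)"
    and asym_free: "asym_free_prob M (\<lambda>n. n) d W"
    and ncps: "nc_prob_space sc star \<tau>"
    and free: "free_vars sc \<tau> {..<d} a"
    and distr: "\<And>i p. i < d \<Longrightarrow> \<tau> (a i ^ p) = complex_of_real (\<integral>x. x ^ p \<partial>\<mu> i)"
    and ws: "set ws \<subseteq> {..<d}"
  shows "((\<lambda>x. ntrace (mat_prod_list (fst x) (map (\<lambda>i. W (fst x) i (snd x)) ws)))
      \<longlongrightarrow> \<tau> (prod_list (map a ws))) (prob_filter M)"
    and "\<tau> (prod_list (map a ws)) \<in> \<real>"
proof -
  let ?F = "prob_filter M"
  \<comment> \<open>\<open>s\<close> and \<open>t\<close> are the centering constants of the random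
    factor and of the limiting one; an unset flag makes them 0 and leaves a plain power.\<close>
  define s where "s x i p b = (if b then ntrace (W (fst x) i (snd x) ^\<^sub>m p) else 0)" for x i p b
  define t where "t i p b = (if b then \<tau> (a i ^ p) else 0)" for i p b
  define V where "V x = (\<lambda>(i, p, b). W (fst x) i (snd x) ^\<^sub>m p - s x i p b \<cdot>\<^sub>m 1\<^sub>m (fst x))" for x
  define v where "v = (\<lambda>(i, p, b). a i ^ p - sc (t i p b) 1)"
  \<comment> \<open>Reality of the limit rides along because the recursion has only moments of the
    \<open>\<mu> i\<close> as coefficients; it later turns a squared modulus into a square.\<close>
  define good where "good l \<longleftrightarrow>
    ((\<lambda>x. ntrace (mat_prod_list (fst x) (map (V x) l))) \<longlongrightarrow> \<tau> (prod_list (map v l))) ?F \<and>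
    \<tau> (prod_list (map v l)) \<in> \<real>" for l
  define ok where "ok l \<longleftrightarrow> fst ` set l \<subseteq> {..<d}" for l :: "(nat \<times> nat \<times> bool) list"
  note \<tau> = nc_prob_spaceD(5-7)[OF ncps] and \<tau>_diff = tau_diff[OF ncps]
    and sc_mult = nc_prob_spaceD(3,4)[OF ncps] and sc_zero = sc_zero[OF ncps]
  have V_carrier: "set (map (V x) l) \<subseteq> carrier_mat (fst x) (fst x)"
    if "ok l" "snd x \<in> space (M (fst x))" for x l
    using that carrier by (auto simp: ok_def V_def intro!: minus_carrier_mat)
  have V_False: "V x (i, p, False) = W (fst x) i (snd x) ^\<^sub>m p"
    if "i < d" "snd x \<in> space (M (fst x))" for x i p
  proof -
    have W: "W (fst x) i (snd x) ^\<^sub>m p \<in> carrier_mat (fst x) (fst x)" using that carrier by auto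
    then show ?thesis by (simp add: V_def s_def minus_zero_smult_one)
  qed
  have v_False: "v (i, p, False) = a i ^ p" for i p by (simp add: v_def t_def sc_zero)
  \<comment> \<open>At n = 0 this trace is 0 instead of 1, so the identity holds only
    eventually.\<close>
  have one: "((\<lambda>x. ntrace (1\<^sub>m (fst x))) \<longlongrightarrow> 1) ?F"
    using eventually_prob_filter_fst[OF eventually_gt_at_top[of 0], of M]
    by (intro tendsto_eventually, eventually_elim) (rule ntrace_one)
  have s_lim: "((\<lambda>x. s x i p b) \<longlongrightarrow> t i p b) ?F" if i: "i < d" for i p b
  \<comment> \<open>Exponent 0 lies outside the convergence hypotheses and is read off from the
    trace of the identity.\<close>
  proof (cases "b \<and> 1 \<le> p")
    case True
    then have "conv_in_prob M (\<lambda>n \<omega>. ntrace (W n i \<omega> ^\<^sub>m p)) (\<tau> (a i ^ p))"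
      using conv[OF i] by (simp add: weak_conv_prob_def distr[OF i])
    from conv_in_prob_imp_tendsto[OF this] True show ?thesis by (simp add: s_def t_def)
  next
    case False
    show ?thesis
    proof (cases b)
      case True
      have "\<forall>\<^sub>F x in ?F. ntrace (1\<^sub>m (fst x)) = s x i p b"
        using eventually_prob_filter_space
      proof eventually_elim
        case (elim x)
        then have "dim_row (W (fst x) i (snd x)) = fst x" using carrier[OF i] by blast
        with True False show ?case by (simp add: s_def not_le)
      qed
      moreover have "p = 0" using True False by simp
      ultimately show ?thesis
        using True Lim_transform_eventually[OF one] by (simp add: t_def \<tau>)
    qed (simp add: s_def t_def)
  qed
  have t_real: "t i p b \<in> \<real>" if "i < d" for i p b
    using that by (simp add: t_def distr)
  \<comment> \<open>Both versions of the factor are compared with the uncentered one; their traces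
    differ by a multiple of the word without that factor.\<close>
  have flip: "good (xs @ (i, p, c) # ys)"
    if G: "good (xs @ (i, p, b) # ys)" "good (xs @ ys)" and ok: "ok (xs @ ys)" "i < d" for xs ys i p b c
  proof -
    let ?f = "\<lambda>l x. ntrace (mat_prod_list (fst x) (map (V x) l))"
    let ?g = "\<lambda>l. \<tau> (prod_list (map v l))"
    have "?f (xs @ (i, p, e) # ys) x = ?f (xs @ (i, p, False) # ys) x - s x i p e * ?f (xs @ ys) x"
      if "snd x \<in> space (M (fst x))" for x e
    proof -
      have "V x (i, p, e) = W (fst x) i (snd x) ^\<^sub>m p - s x i p e \<cdot>\<^sub>m 1\<^sub>m (fst x)" by (simp add: V_def)
      moreover have "ok xs" "ok ys" using ok by (auto simp: ok_def)
      ultimately show ?thesis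
        using ntrace_prod_list_shift[OF V_carrier[OF _ that] V_carrier[OF _ that], of xs ys
            "W (fst x) i (snd x) ^\<^sub>m p" "s x i p e"] carrier[OF ok(2) that] V_False[OF ok(2) that]
        by simp
    qed
    from this[of _ c] this[of _ b]
    have eq: "?f (xs @ (i, p, c) # ys) x
        = ?f (xs @ (i, p, b) # ys) x + (s x i p b - s x i p c) * ?f (xs @ ys) x"
      if "snd x \<in> space (M (fst x))" for x
      using that by (simp add: algebra_simps)
    have "?g (xs @ (i, p, e) # ys) = ?g (xs @ (i, p, False) # ys) - t i p e * ?g (xs @ ys)" for e
    proof -
      have "prod_list (map v xs) * (sc (t i p e) 1 * prod_list (map v ys))
          = sc (t i p e) (prod_list (map v xs) * prod_list (map v ys))"
        by (metis mult_1 sc_mult)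
      then show ?thesis
        by (simp add: v_def[THEN fun_cong] t_def sc_zero right_diff_distrib left_diff_distrib \<tau>_diff \<tau>)
    qed
    from this[of c] this[of b]
    have eq': "?g (xs @ (i, p, c) # ys) = ?g (xs @ (i, p, b) # ys) + (t i p b - t i p c) * ?g (xs @ ys)"
      by (simp add: algebra_simps)
    have "((\<lambda>x. ?f (xs @ (i, p, b) # ys) x + (s x i p b - s x i p c) * ?f (xs @ ys) x)
        \<longlongrightarrow> ?g (xs @ (i, p, c) # ys)) ?F"
      unfolding eq' using G by (intro tendsto_intros s_lim ok) (auto simp: good_def)
    then have "(?f (xs @ (i, p, c) # ys) \<longlongrightarrow> ?g (xs @ (i, p, c) # ys)) ?F"
      by (rule Lim_transform_eventually)
        (use eventually_prob_filter_space in \<open>eventually_elim, simp only: eq\<close>)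
    moreover have "?g (xs @ (i, p, c) # ys) \<in> \<real>"
      unfolding eq' using G t_real[OF ok(2)] by (auto simp: good_def)
    ultimately show ?thesis by (simp add: good_def)
  qed
  have "ok l \<longrightarrow> good l" for l
  proof (induction l rule: length_induct)
    case (1 l)
    \<comment> \<open>The prefix already carries its final flags, while the rest has the common flag
      \<open>c\<close>. The boundary moves one letter at a time, and each move is paid for by a
      shorter word from the outer induction.\<close>
    have reflag: "good (pre @ r)"
      if "good (pre @ map (\<lambda>(i, p, _). (i, p, c)) r)" "ok (pre @ r)" "length (pre @ r) = length l" for pre r c
      using that
    proof (induction r arbitrary: pre)
      case (Cons y r)
      obtain i p b where y: "y = (i, p, b)" by (cases y)
      let ?r = "map (\<lambda>(i, p, _). (i, p, c)) r"
      have "ok (pre @ ?r)" "i < d" using Cons.prems(2) by (auto simp: ok_def y)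
      moreover have "good (pre @ ?r)" using 1[rule_format, of "pre @ ?r"] calculation(1) Cons.prems(3) by simp
      ultimately have "good (pre @ (i, p, b) # ?r)"
        using Cons.prems(1) flip[of pre i p c ?r b] by (simp add: y)
      then show ?case using Cons.IH[of "pre @ [y]"] Cons.prems by (simp add: y)
    qed simp
    show ?case
    proof
      assume okl: "ok l"
      let ?u = "\<lambda>c. map (\<lambda>(i, p, _). (i, p, c :: bool))"
      \<comment> \<open>Exponent 0 forms a case of its own because \<open>adm_words\<close> admits
        positive exponents only; such an uncentered factor is the identity and can be
        deleted.\<close>
      consider "l = []" | xs i b ys where "l = xs @ (i, 0, b) # ys"
        | xs i p b q e ys where "l = xs @ (i, p, b) # (i, q, e) # ys"
        | "l \<noteq> []" "\<And>k. Suc k < length l \<Longrightarrow> fst (l ! k) \<noteq> fst (l ! Suc k)" "\<And>y. y \<in> set l \<Longrightarrow> 1 \<le> fst (snd y)"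
      proof -
        {
          fix y assume "y \<in> set l" "\<not> 1 \<le> fst (snd y)"
          then have "\<exists>xs i b ys. l = xs @ (i, 0, b) # ys"
            using split_list[of y l] by (metis One_nat_def less_one not_le prod.collapse)
        }
        moreover {
          fix k assume k: "Suc k < length l" "fst (l ! k) = fst (l ! Suc k)"
          have "l = take k l @ l ! k # l ! Suc k # drop (Suc (Suc k)) l"
            using k(1) by (simp add: Cons_nth_drop_Suc)
          then have "\<exists>xs i p b q e ys. l = xs @ (i, p, b) # (i, q, e) # ys"
            using k(2) by (metis prod.collapse)
        }
        ultimately show thesis using that by blast
      qed
      then show "good l"
      proof cases
        case 1
        then show ?thesis using one by (simp add: good_def \<tau>)
      next
        case l: (2 xs i b ys)
        let ?l = "?u False xs @ ?u False ys"
        have ok': "ok ?l" "i < d" "ok (?u False xs)" "ok (?u False ys)" using okl by (auto simp: l ok_def)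
        have "good ?l" using 1[rule_format, of ?l] ok'(1) by (simp add: l)
        moreover have "\<forall>\<^sub>F x in ?F. ntrace (mat_prod_list (fst x) (map (V x) ?l))
            = ntrace (mat_prod_list (fst x) (map (V x) (?u False l)))"
          using eventually_prob_filter_space
        proof eventually_elim
          case (elim x)
          have "V x (i, 0, False) = 1\<^sub>m (fst x)"
            using V_False[OF ok'(2) elim] carrier[OF ok'(2) elim] by simp
          then show ?case
            using V_carrier[OF ok'(3) elim] V_carrier[OF ok'(4) elim]
            by (simp add: l mat_prod_list_append left_mult_one_mat[of _ "fst x" "fst x"] del: map_map)
        qed
        ultimately have "good (?u False l)"
          by (auto simp: good_def l v_False intro: Lim_transform_eventually)
        then show ?thesis using reflag[of "[]" False l] okl by simp
      next
        case l: (3 xs i p b q e ys)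
        let ?l = "?u False xs @ (i, p + q, False) # ?u False ys"
        have ok': "ok ?l" "i < d" "ok (?u False xs)" "ok (?u False ys)" using okl by (auto simp: l ok_def)
        have "good ?l" using 1[rule_format, of ?l] ok'(1) by (simp add: l)
        moreover have "\<forall>\<^sub>F x in ?F. ntrace (mat_prod_list (fst x) (map (V x) ?l))
            = ntrace (mat_prod_list (fst x) (map (V x) (?u False l)))"
          using eventually_prob_filter_space
        proof eventually_elim
          case (elim x)
          have W: "W (fst x) i (snd x) \<in> carrier_mat (fst x) (fst x)" by (rule carrier[OF ok'(2) elim])
          have "V x (i, p + q, False) = V x (i, p, False) * V x (i, q, False)"
            by (simp add: V_False[OF ok'(2) elim] pow_mat_add[OF W])
          moreover have "V x (i, r, False) \<in> carrier_mat (fst x) (fst x)" for r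
            using W by (simp add: V_False[OF ok'(2) elim])
          ultimately show ?case
            using V_carrier[OF ok'(3) elim] V_carrier[OF ok'(4) elim]
            by (simp add: l mat_prod_list_append assoc_mult_mat[of _ "fst x" "fst x" _ "fst x" _ "fst x"]
                mult_carrier_mat[of _ "fst x" "fst x" _ "fst x"] del: map_map)
        qed
        moreover have "prod_list (map v ?l) = prod_list (map v (?u False l))"
          by (simp add: l v_False power_add mult.assoc)
        ultimately have "good (?u False l)"
          by (auto simp: good_def intro: Lim_transform_eventually)
        then show ?thesis using reflag[of "[]" False l] okl by simp
      next
        case 4
        let ?ip = "map (\<lambda>(i, p, _). (i, p)) l"
        let ?is = "map fst ?ip" and ?ps = "map snd ?ip"
        have zip: "zip ?is ?ps = ?ip" by (rule zip_map_fst_snd)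
        have adm: "adm_words d ?is ?ps"
          using 4 okl unfolding adm_words_def ok_def by (auto simp: case_prod_unfold)
        have "conv_in_prob M (\<lambda>n \<omega>. ntrace (mat_prod_list n
            (map (\<lambda>(i, p). W n i \<omega> ^\<^sub>m p - ntrace (W n i \<omega> ^\<^sub>m p) \<cdot>\<^sub>m 1\<^sub>m n) ?ip))) 0"
          using asym_free[unfolded asym_free_prob_def, rule_format, OF adm] by (simp only: zip)
        from conv_in_prob_imp_tendsto[OF this]
        have "((\<lambda>x. ntrace (mat_prod_list (fst x) (map (V x) (?u True l)))) \<longlongrightarrow> 0) ?F"
          by (simp add: V_def s_def case_prod_unfold o_def)
        moreover have "\<tau> (prod_list (map v (?u True l))) = 0"
          using free_centered_prod_list[OF ncps free, of ?ip] 4 okl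
          by (auto simp: v_def t_def case_prod_unfold o_def ok_def image_image)
        ultimately have "good (?u True l)" by (simp add: good_def)
        then show ?thesis using reflag[of "[]" True l] okl by simp
      qed
    qed
  qed
  moreover have "ok (map (\<lambda>i. (i, 1, False)) ws)" using ws by (auto simp: ok_def)
  ultimately have G: "good (map (\<lambda>i. (i, 1, False)) ws)" by blast
  have v: "map v (map (\<lambda>i. (i, 1, False)) ws) = map a ws" by (simp add: v_False)
  have "\<forall>\<^sub>F x in ?F. ntrace (mat_prod_list (fst x) (map (V x) (map (\<lambda>i. (i, 1, False)) ws)))
      = ntrace (mat_prod_list (fst x) (map (\<lambda>i. W (fst x) i (snd x)) ws))"
    using eventually_prob_filter_space
  proof eventually_elim
    case (elim x)
    have "V x (i, 1, False) = W (fst x) i (snd x)" if "i \<in> set ws" for i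
    proof -
      have "i < d" using ws that by auto
      then show ?thesis
        using V_False[OF _ elim, of i 1] carrier[OF _ elim, of i] by (simp add: left_mult_one_mat')
    qed
    then have "map (V x) (map (\<lambda>i. (i, 1, False)) ws) = map (\<lambda>i. W (fst x) i (snd x)) ws" by simp
    then show ?case by (simp only:)
  qed
  with G show "((\<lambda>x. ntrace (mat_prod_list (fst x) (map (\<lambda>i. W (fst x) i (snd x)) ws)))
      \<longlongrightarrow> \<tau> (prod_list (map a ws))) (prob_filter M)"
    unfolding good_def v by (auto intro: Lim_transform_eventually)
  show "\<tau> (prod_list (map a ws)) \<in> \<real>" using G unfolding good_def v by blast
qed

section \<open>Words in the Kronecker squares and their means\<close>

lemma mat_adjoint_pow:
  fixes A :: "complex mat"
  assumes "A \<in> carrier_mat N N"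
  shows "mat_adjoint (A ^\<^sub>m p) = mat_adjoint A ^\<^sub>m p"
proof (induction p)
  case 0
  then show ?case using assms by (simp add: mat_adjoint_one)
next
  case (Suc p)
  have "mat_adjoint (A ^\<^sub>m Suc p) = mat_adjoint A * mat_adjoint A ^\<^sub>m p"
    using assms by (simp add: mat_adjoint_mult[of _ N N _ N] Suc)
  then show ?case using assms by (simp add: pow_mat_Suc_left[of _ N] del: pow_mat.simps)
qed

lemma smult_pow_mat:
  fixes A :: "complex mat"
  assumes "A \<in> carrier_mat N N"
  shows "(c \<cdot>\<^sub>m A) ^\<^sub>m p = c ^ p \<cdot>\<^sub>m A ^\<^sub>m p"
proof (induction p)
  case (Suc p)
  have smult: "x \<cdot>\<^sub>m (y \<cdot>\<^sub>m B) = (x * y) \<cdot>\<^sub>m B" for x y and B :: "complex mat"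
    by (rule eq_matI) auto
  from Suc show ?case
    using assms by (simp add: mult_smult_assoc_mat[of _ N N _ N] mult_smult_distrib[of _ N N _ N] smult mult.commute)
qed (use assms in \<open>auto intro!: eq_matI\<close>)

text \<open>\<open>norm_ntrace_le\<close> applied to a power. It replaces the square of a random
  trace by a single trace, whose expectation is controlled.\<close>

lemma ntrace_hermitian_even_pow:
  assumes A: "A \<in> carrier_mat N N" and herm: "mat_adjoint A = A"
  shows "(cmod (ntrace (A ^\<^sub>m p)))\<^sup>2 \<le> Re (ntrace (A ^\<^sub>m (2 * p)))"
  using norm_ntrace_le[of "A ^\<^sub>m p" N] A
  by (simp add: mat_adjoint_pow[OF A] herm mult_2 pow_mat_add[OF A])

lemma ntrace_mult_sum_mult:
  assumes "finite I" and P: "P \<in> carrier_mat N N" and R: "R \<in> carrier_mat N N"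
    and f: "\<And>i. i \<in> I \<Longrightarrow> f i \<in> carrier_mat N N"
  shows "ntrace (P * (mat_sum N f I * R)) = (\<Sum>i\<in>I. ntrace (P * (f i * R)))"
  using \<open>finite I\<close> f
proof (induction I)
  case empty
  have "mat_sum N f {} = 0\<^sub>m N N" by (auto simp: mat_sum_def)
  then show ?case using P R by (simp add: ntrace_sum[of _ N])
next
  case (insert i I)
  have "mat_sum N f (insert i I) = f i + mat_sum N f I"
    using insert by (intro eq_matI) (auto simp: mat_sum_def)
  then have "P * (mat_sum N f (insert i I) * R) = P * (f i * R) + P * (mat_sum N f I * R)"
    using P R insert.prems
    by (simp add: add_mult_distrib_mat[of _ N N _ _ N] mult_add_distrib_mat[of _ N N _ N]
        mult_carrier_mat[of _ N N _ N])
  then show ?case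
    using insert P R by (simp add: ntrace_add[of _ N] mult_carrier_mat[of _ N N _ N])
qed

section \<open>Linear combinations under both modes of convergence\<close>

definition conv_both :: "(nat \<Rightarrow> 'a measure) \<Rightarrow> (nat \<Rightarrow> 'a \<Rightarrow> complex) \<Rightarrow> complex \<Rightarrow> bool" where
  "conv_both M Y c \<longleftrightarrow> conv_in_prob M Y c \<and> conv_in_exp M Y c"

lemma conv_both_cong:
  assumes "\<And>n \<omega>. \<omega> \<in> space (M n) \<Longrightarrow> Y n \<omega> = Z n \<omega>"
  shows "conv_both M Y c \<longleftrightarrow> conv_both M Z c"
proof -
  have "Y n \<in> borel_measurable (M n) \<longleftrightarrow> Z n \<in> borel_measurable (M n)" for n
    using assms by (intro measurable_cong) auto
  moreover have "{\<omega> \<in> space (M n). e < cmod (Y n \<omega> - c)} = {\<omega> \<in> space (M n). e < cmod (Z n \<omega> - c)}" for n e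
    using assms by auto
  moreover have "integrable (M n) (Y n) \<longleftrightarrow> integrable (M n) (Z n)" for n
    using assms by (intro Bochner_Integration.integrable_cong) auto
  moreover have "(\<integral>\<omega>. Y n \<omega> \<partial>M n) = (\<integral>\<omega>. Z n \<omega> \<partial>M n)" for n
    using assms by (intro Bochner_Integration.integral_cong) auto
  ultimately show ?thesis by (simp add: conv_both_def conv_in_prob_def conv_in_exp_def)
qed

lemma conv_both_diff:
  assumes prob: "\<And>n. prob_space (M n)" and YZ: "conv_both M Y b" "conv_both M Z c"
  shows "conv_both M (\<lambda>n \<omega>. Y n \<omega> - Z n \<omega>) (b - c)"
proof -
  have meas: "(\<lambda>\<omega>. Y n \<omega> - Z n \<omega>) \<in> borel_measurable (M n)" for n
    using YZ by (intro borel_measurable_diff) (auto simp: conv_both_def conv_in_prob_def)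
  have "conv_in_prob M (\<lambda>n \<omega>. Y n \<omega> - Z n \<omega>) (b - c)"
  proof (rule tendsto_imp_conv_in_prob[OF prob meas])
    show "((\<lambda>x. Y (fst x) (snd x) - Z (fst x) (snd x)) \<longlongrightarrow> b - c) (prob_filter M)"
      using YZ by (intro tendsto_diff conv_in_prob_imp_tendsto) (auto simp: conv_both_def)
  qed
  moreover have "conv_in_exp M (\<lambda>n \<omega>. Y n \<omega> - Z n \<omega>) (b - c)"
    using YZ by (auto simp: conv_both_def conv_in_exp_def intro: tendsto_diff)
  ultimately show ?thesis by (simp add: conv_both_def)
qed

lemma conv_both_sum:
  assumes prob: "\<And>n. prob_space (M n)" and Y: "\<And>i. i \<in> I \<Longrightarrow> conv_both M (Y i) (c i)"
  shows "conv_both M (\<lambda>n \<omega>. \<Sum>i\<in>I. Y i n \<omega>) (\<Sum>i\<in>I. c i)"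
proof -
  have meas: "(\<lambda>\<omega>. \<Sum>i\<in>I. Y i n \<omega>) \<in> borel_measurable (M n)" for n
    using Y by (auto simp: conv_both_def conv_in_prob_def intro!: borel_measurable_sum)
  have "conv_in_prob M (\<lambda>n \<omega>. \<Sum>i\<in>I. Y i n \<omega>) (\<Sum>i\<in>I. c i)"
  proof (rule tendsto_imp_conv_in_prob[OF prob meas])
    show "((\<lambda>x. \<Sum>i\<in>I. Y i (fst x) (snd x)) \<longlongrightarrow> (\<Sum>i\<in>I. c i)) (prob_filter M)"
      using Y by (intro tendsto_sum conv_in_prob_imp_tendsto) (auto simp: conv_both_def)
  qed
  moreover have "conv_in_exp M (\<lambda>n \<omega>. \<Sum>i\<in>I. Y i n \<omega>) (\<Sum>i\<in>I. c i)"
    using Y by (auto simp: conv_both_def conv_in_exp_def intro: tendsto_sum)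
  ultimately show ?thesis by (simp add: conv_both_def)
qed

lemma conv_both_mult_left:
  assumes prob: "\<And>n. prob_space (M n)" and Y: "conv_both M Y c"
  shows "conv_both M (\<lambda>n \<omega>. b * Y n \<omega>) (b * c)"
proof -
  have meas: "(\<lambda>\<omega>. b * Y n \<omega>) \<in> borel_measurable (M n)" for n
    using Y by (intro borel_measurable_times borel_measurable_const) (auto simp: conv_both_def conv_in_prob_def)
  have "conv_in_prob M (\<lambda>n \<omega>. b * Y n \<omega>) (b * c)"
  proof (rule tendsto_imp_conv_in_prob[OF prob meas])
    show "((\<lambda>x. b * Y (fst x) (snd x)) \<longlongrightarrow> b * c) (prob_filter M)"
      using Y by (intro tendsto_mult_left conv_in_prob_imp_tendsto) (auto simp: conv_both_def)
  qed
  moreover have "conv_in_exp M (\<lambda>n \<omega>. b * Y n \<omega>) (b * c)"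
    using Y by (auto simp: conv_both_def conv_in_exp_def intro: tendsto_mult_left)
  ultimately show ?thesis by (simp add: conv_both_def)
qed

lemma weak_conv_of_moments:
  assumes "moment_measure \<nu>" "\<And>n \<omega>. \<omega> \<in> space (M n) \<Longrightarrow> X n \<omega> \<in> carrier_mat (N n) (N n)"
    and conv: "\<And>p. conv_both M (\<lambda>n \<omega>. ntrace (X n \<omega> ^\<^sub>m p)) (complex_of_real (\<integral>x. x ^ p \<partial>\<nu>))"
  shows "weak_conv_prob M X \<nu>" "weak_conv_exp M X \<nu>"
proof -
  have "integrable (M n) (\<lambda>\<omega>. mtrace (X n \<omega> ^\<^sub>m p))" for n p
  proof -
    have "integrable (M n) (\<lambda>\<omega>. of_nat (N n) * ntrace (X n \<omega> ^\<^sub>m p))"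
      using conv[of p] by (intro integrable_mult_right) (auto simp: conv_both_def conv_in_exp_def)
    also have "?this \<longleftrightarrow> ?thesis"
      using assms(2) by (intro Bochner_Integration.integrable_cong) (auto simp: mtrace_eq_ntrace[of _ "N n"])
    finally show ?thesis .
  qed
  with assms(1) conv show "weak_conv_prob M X \<nu>" "weak_conv_exp M X \<nu>"
    by (auto simp: weak_conv_prob_def weak_conv_exp_def conv_both_def)
qed

text \<open>Freeness matters below only through the limits \<open>t\<close> of word traces and their
  reality, so the locale keeps these two facts and abstracts from the algebra containing the free
  variables.\<close>

locale kron_conj_sum =
  fixes d :: nat and M :: "nat \<Rightarrow> 'a measure" and W :: "nat \<Rightarrow> nat \<Rightarrow> 'a \<Rightarrow> complex mat"
    and \<mu> :: "nat \<Rightarrow> real measure" and t :: "nat list \<Rightarrow> complex"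
  assumes prob: "\<And>n. prob_space (M n)"
    and carrier: "\<And>n i \<omega>. i < d \<Longrightarrow> \<omega> \<in> space (M n) \<Longrightarrow> W n i \<omega> \<in> carrier_mat n n"
    and herm: "\<And>n i \<omega>. i < d \<Longrightarrow> \<omega> \<in> space (M n) \<Longrightarrow> mat_adjoint (W n i \<omega>) = W n i \<omega>"
    and meas: "\<And>n i j k. i < d \<Longrightarrow> j < n \<Longrightarrow> k < n \<Longrightarrow>
                 (\<lambda>\<omega>. W n i \<omega> $$ (j, k)) \<in> borel_measurable (M n)"
    and conv_prob: "\<And>i. i < d \<Longrightarrow> weak_conv_prob M (\<lambda>n. W n i) (\<mu> i)"
    and conv_exp: "\<And>i. i < d \<Longrightarrow> weak_conv_exp M (\<lambda>n. W n i) (\<mu> i)"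
    and mean_kron: "\<And>i p. i < d \<Longrightarrow> 1 \<le> p \<Longrightarrow>
      (\<lambda>n. ntrace (mat_expect (M n) (n * n) (\<lambda>\<omega>. kron (W n i \<omega>) (mat_conj (W n i \<omega>))) ^\<^sub>m p))
        \<longlonglongrightarrow> 0"
    and word: "\<And>ws. set ws \<subseteq> {..<d} \<Longrightarrow>
      ((\<lambda>x. ntrace (mat_prod_list (fst x) (map (\<lambda>i. W (fst x) i (snd x)) ws))) \<longlongrightarrow> t ws) (prob_filter M)"
    and word_real: "\<And>ws. set ws \<subseteq> {..<d} \<Longrightarrow> t ws \<in> \<real>"
begin

section \<open>Kronecker squares, their means and the dominating variable\<close>

definition X :: "nat \<Rightarrow> nat \<Rightarrow> 'a \<Rightarrow> complex mat" where
  "X n i \<omega> = kron (W n i \<omega>) (mat_conj (W n i \<omega>))"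

definition E :: "nat \<Rightarrow> nat \<Rightarrow> complex mat" where
  "E n i = mat_expect (M n) (n * n) (X n i)"

definition S :: "nat \<Rightarrow> 'a \<Rightarrow> complex mat" where
  "S n \<omega> = mat_sum (n * n) (\<lambda>i. X n i \<omega> - E n i) {..<d}"

definition L :: "nat \<Rightarrow> 'a \<Rightarrow> nat \<times> bool \<Rightarrow> complex mat" where
  "L n \<omega> = (\<lambda>(i, e). if e then E n i else X n i \<omega>)"

text \<open>For \<open>q = 2 ^ Suc k\<close>, dominates the squared trace of every word of length at most \<open>k\<close>.\<close>
definition C :: "nat \<Rightarrow> nat \<Rightarrow> 'a \<Rightarrow> real" where
  "C q n \<omega> = 1 + (\<Sum>i<d. Re (ntrace (W n i \<omega> ^\<^sub>m (2 * q)))) + (\<Sum>i<d. Re (ntrace (E n i ^\<^sub>m q)))"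

lemma X_carrier: "i < d \<Longrightarrow> \<omega> \<in> space (M n) \<Longrightarrow> X n i \<omega> \<in> carrier_mat (n * n) (n * n)"
  using carrier by (simp add: X_def)

lemma E_carrier [simp]: "E n i \<in> carrier_mat (n * n) (n * n)"
  by (simp add: E_def mat_expect_def)

lemma E_dim [simp]: "dim_row (E n i) = n * n" "dim_col (E n i) = n * n"
  by (rule carrier_matD[OF E_carrier])+

lemma L_carrier:
  "fst ` set u \<subseteq> {..<d} \<Longrightarrow> \<omega> \<in> space (M n) \<Longrightarrow> set (map (L n \<omega>) u) \<subseteq> carrier_mat (n * n) (n * n)"
  using X_carrier by (auto simp: L_def)

lemma S_carrier [simp]: "S n \<omega> \<in> carrier_mat (n * n) (n * n)"
  by (simp add: S_def)

lemma S_dim [simp]: "dim_row (S n \<omega>) = n * n" "dim_col (S n \<omega>) = n * n"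
  by (rule carrier_matD[OF S_carrier])+

lemma X_hermitian: "i < d \<Longrightarrow> \<omega> \<in> space (M n) \<Longrightarrow> mat_adjoint (X n i \<omega>) = X n i \<omega>"
  using herm by (simp add: X_def mat_adjoint_kron mat_adjoint_conj)

lemma E_hermitian:
  assumes "i < d"
  shows "mat_adjoint (E n i) = E n i"
proof (rule eq_matI)
  fix j k assume "j < dim_row (E n i)" "k < dim_col (E n i)"
  then have jk: "j < n * n" "k < n * n" using E_carrier[of n i] by auto
  have "mat_adjoint (E n i) $$ (j, k) = cnj (E n i $$ (k, j))"
    using jk E_carrier[of n i] by (intro index_mat_adjoint) auto
  also have "\<dots> = (\<integral>\<omega>. cnj (X n i \<omega> $$ (k, j)) \<partial>M n)"
    using jk by (simp add: E_def mat_expect_def)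
  also have "\<dots> = (\<integral>\<omega>. X n i \<omega> $$ (j, k) \<partial>M n)"
  proof (intro Bochner_Integration.integral_cong refl)
    fix \<omega> assume \<omega>: "\<omega> \<in> space (M n)"
    have "mat_adjoint (X n i \<omega>) $$ (j, k) = cnj (X n i \<omega> $$ (k, j))"
      using jk X_carrier[OF assms \<omega>] by (intro index_mat_adjoint) auto
    then show "cnj (X n i \<omega> $$ (k, j)) = X n i \<omega> $$ (j, k)" by (simp add: X_hermitian[OF assms \<omega>])
  qed
  also have "\<dots> = E n i $$ (j, k)" using jk by (simp add: E_def mat_expect_def)
  finally show "mat_adjoint (E n i) $$ (j, k) = E n i $$ (j, k)" .
qed (use E_carrier[of n i] in auto)

lemma L_hermitian: "fst y < d \<Longrightarrow> \<omega> \<in> space (M n) \<Longrightarrow> mat_adjoint (L n \<omega> y) = L n \<omega> y"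
  by (auto simp: L_def X_hermitian E_hermitian split: prod.splits)

lemma S_hermitian:
  assumes \<omega>: "\<omega> \<in> space (M n)"
  shows "mat_adjoint (S n \<omega>) = S n \<omega>"
proof (rule eq_matI)
  fix j k assume "j < dim_row (S n \<omega>)" "k < dim_col (S n \<omega>)"
  then have jk: "j < n * n" "k < n * n" by (auto simp: S_def mat_sum_def)
  have adj: "cnj (A $$ (k, j)) = A $$ (j, k)" if "A \<in> carrier_mat (n * n) (n * n)" "mat_adjoint A = A" for A
    using index_mat_adjoint[of j A k] jk that by auto
  have "cnj (X n i \<omega> $$ (k, j)) = X n i \<omega> $$ (j, k)" "cnj (E n i $$ (k, j)) = E n i $$ (j, k)"
    if "i < d" for i
    using that \<omega> by (auto intro!: adj X_carrier X_hermitian E_hermitian)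
  then have "cnj ((X n i \<omega> - E n i) $$ (k, j)) = (X n i \<omega> - E n i) $$ (j, k)" if "i < d" for i
    using jk that by simp
  then have "cnj (S n \<omega> $$ (k, j)) = S n \<omega> $$ (j, k)"
    using jk by (simp add: S_def mat_sum_def)
  then show "mat_adjoint (S n \<omega>) $$ (j, k) = S n \<omega> $$ (j, k)"
    using jk by (subst index_mat_adjoint) (auto simp: S_def mat_sum_def)
qed (auto simp: S_def mat_sum_def)

lemma mat_measurable_L:
  assumes "fst y < d"
  shows "mat_measurable (M n) (n * n) (\<lambda>\<omega>. L n \<omega> y)"
proof -
  obtain i e where y: "y = (i, e)" by (cases y)
  have "mat_measurable (M n) n (W n i)"
    using assms carrier meas by (auto simp: mat_measurable_def y)
  then have "mat_measurable (M n) (n * n) (X n i)"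
    unfolding X_def by (rule mat_measurable_kron_conj)
  then show ?thesis using mat_measurable_const[OF E_carrier] by (cases e) (simp_all add: L_def y)
qed

lemma ntrace_W_pow_nonneg:
  "i < d \<Longrightarrow> \<omega> \<in> space (M n) \<Longrightarrow> 0 \<le> Re (ntrace (W n i \<omega> ^\<^sub>m (2 * p)))"
  using ntrace_hermitian_even_pow[OF carrier herm] by (meson order_trans zero_le_power2)

lemma ntrace_E_pow_nonneg: "i < d \<Longrightarrow> even q \<Longrightarrow> 0 \<le> Re (ntrace (E n i ^\<^sub>m q))"
  using ntrace_hermitian_even_pow[OF E_carrier E_hermitian, of i n "q div 2"]
  by (auto intro: order_trans[OF zero_le_power2])

lemma C_sums_nonneg:
  assumes "\<omega> \<in> space (M n)"
  shows "0 \<le> (\<Sum>i<d. Re (ntrace (W n i \<omega> ^\<^sub>m (2 * q))))"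
    and "even q \<Longrightarrow> 0 \<le> (\<Sum>i<d. Re (ntrace (E n i ^\<^sub>m q)))"
  using ntrace_W_pow_nonneg[OF _ assms] ntrace_E_pow_nonneg by (auto intro!: sum_nonneg)

text \<open>The leading 1 of \<open>C\<close> accommodates the identities that pad a word; the other
  summands are traces of even powers of Hermitian matrices.\<close>

lemma C_ge_1: "\<omega> \<in> space (M n) \<Longrightarrow> even q \<Longrightarrow> 1 \<le> C q n \<omega>"
  using C_sums_nonneg[of \<omega> n q] unfolding C_def by linarith

text \<open>The trace of a power of \<open>X n i \<omega>\<close> is the squared modulus of a trace
  in \<open>W n i \<omega>\<close>, which Cauchy-Schwarz turns into a single trace of doubled
  exponent. This explains \<open>2 * q\<close> next to \<open>q\<close> in \<open>C\<close>.\<close>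

lemma ntrace_L_pow_le:
  assumes y: "fst y < d" and \<omega>: "\<omega> \<in> space (M n)" and q: "even q"
  shows "Re (ntrace (L n \<omega> y ^\<^sub>m q)) \<le> C q n \<omega>"
proof -
  obtain i e where ie: "y = (i, e)" by (cases y)
  have i: "i < d" using y by (simp add: ie)
  note sums = C_sums_nonneg(1)[OF \<omega>, of q] C_sums_nonneg(2)[OF \<omega> q]
  show ?thesis
  proof (cases e)
    case True
    have "Re (ntrace (E n i ^\<^sub>m q)) \<le> (\<Sum>i<d. Re (ntrace (E n i ^\<^sub>m q)))"
      using i ntrace_E_pow_nonneg[OF _ q] by (intro member_le_sum) auto
    then have "Re (ntrace (E n i ^\<^sub>m q)) \<le> C q n \<omega>" using sums unfolding C_def by linarith
    then show ?thesis using True by (simp add: L_def ie)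
  next
    case False
    have W: "W n i \<omega> \<in> carrier_mat n n" by (rule carrier[OF i \<omega>])
    have "X n i \<omega> ^\<^sub>m q = mat_prod_list (n * n) (map (\<lambda>A. kron A (mat_conj A)) (replicate q (W n i \<omega>)))"
      using X_carrier[OF i \<omega>] by (simp add: X_def mat_prod_list_replicate)
    also have "ntrace \<dots> = of_real ((cmod (ntrace (mat_prod_list n (replicate q (W n i \<omega>)))))\<^sup>2)"
      using W by (intro ntrace_word_kron_conj) auto
    also have "mat_prod_list n (replicate q (W n i \<omega>)) = W n i \<omega> ^\<^sub>m q"
      by (rule mat_prod_list_replicate[OF W])
    finally have "Re (ntrace (X n i \<omega> ^\<^sub>m q)) = (cmod (ntrace (W n i \<omega> ^\<^sub>m q)))\<^sup>2"
      by (simp only: Re_complex_of_real)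
    also have "\<dots> \<le> Re (ntrace (W n i \<omega> ^\<^sub>m (2 * q)))"
      by (rule ntrace_hermitian_even_pow[OF W herm[OF i \<omega>]])
    also have "\<dots> \<le> (\<Sum>i<d. Re (ntrace (W n i \<omega> ^\<^sub>m (2 * q))))"
      using i ntrace_W_pow_nonneg[OF _ \<omega>] by (intro member_le_sum) auto
    finally have "Re (ntrace (X n i \<omega> ^\<^sub>m q)) \<le> C q n \<omega>" using sums unfolding C_def by linarith
    then show ?thesis using False by (simp add: L_def ie)
  qed
qed

text \<open>The letters are Hermitian, so the adjoint of a word is its reversal and the left side is
  the trace of a word of length at most \<open>2 * k\<close>, within reach of Hoelder's bound
  because \<open>2 * k \<le> 2 ^ Suc k\<close>.\<close>

lemma ntrace_L_word_le:
  assumes u: "fst ` set u \<subseteq> {..<d}" and \<omega>: "\<omega> \<in> space (M n)" and len: "length u \<le> k"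
  shows "Re (ntrace (mat_adjoint (mat_prod_list (n * n) (map (L n \<omega>) u)) * mat_prod_list (n * n) (map (L n \<omega>) u)))
    \<le> C (2 ^ Suc k) n \<omega>"
proof -
  have adj: "map mat_adjoint (map (L n \<omega>) u) = map (L n \<omega>) u"
    using u L_hermitian[OF _ \<omega>] by auto
  have u': "fst ` set (rev u @ u) \<subseteq> {..<d}" using u by auto
  have "length (map (L n \<omega>) (rev u @ u)) \<le> 2 * k" using len by simp
  also have "\<dots> \<le> 2 ^ Suc k" using less_exp[of k] by simp
  finally have len': "length (map (L n \<omega>) (rev u @ u)) \<le> 2 ^ Suc k" .
  have "mat_adjoint (mat_prod_list (n * n) (map (L n \<omega>) u)) * mat_prod_list (n * n) (map (L n \<omega>) u)
      = mat_prod_list (n * n) (map (L n \<omega>) (rev u @ u))"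
    unfolding mat_adjoint_prod_list[OF L_carrier[OF u \<omega>]] adj
    using L_carrier[OF u \<omega>] by (simp add: mat_prod_list_append rev_map)
  moreover have "cmod (ntrace (mat_prod_list (n * n) (map (L n \<omega>) (rev u @ u)))) \<le> C (2 ^ Suc k) n \<omega>"
  proof (rule ntrace_hermitian_word_le[OF len' C_ge_1[OF \<omega>] L_carrier[OF u' \<omega>]], simp)
    fix A assume "A \<in> set (map (L n \<omega>) (rev u @ u))"
    then obtain y where "A = L n \<omega> y" "fst y < d" using u by auto
    then show "mat_adjoint A = A" and "Re (ntrace (A ^\<^sub>m 2 ^ Suc k)) \<le> C (2 ^ Suc k) n \<omega>"
      using L_hermitian[OF _ \<omega>] ntrace_L_pow_le[OF _ \<omega>, of _ "2 ^ Suc k"] by auto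
  qed
  ultimately show ?thesis using complex_Re_le_cmod order_trans by metis
qed

lemma integrable_W_pow:
  assumes "i < d" "1 \<le> q"
  shows "integrable (M n) (\<lambda>\<omega>. ntrace (W n i \<omega> ^\<^sub>m q))"
  using conv_exp[OF assms(1)] assms(2) by (auto simp: weak_conv_exp_def conv_in_exp_def)

lemma integrable_C: "1 \<le> q \<Longrightarrow> integrable (M n) (C q n)"
proof -
  interpret prob_space "M n" by (rule prob)
  assume "1 \<le> q"
  then show ?thesis
    unfolding C_def
    by (intro Bochner_Integration.integrable_add Bochner_Integration.integrable_sum integrable_const
        integrable_Re integrable_W_pow) auto
qed

text \<open>The expected traces converge, and so do the traces of powers of the means; convergent
  sequences are bounded.\<close>

lemma bounded_integral_C:
  assumes q: "1 \<le> q"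
  shows "\<exists>B. \<forall>n. (\<integral>\<omega>. C q n \<omega> \<partial>M n) \<le> B"
proof -
  have int: "integrable (M n) (\<lambda>\<omega>. Re (ntrace (W n i \<omega> ^\<^sub>m (2 * q))))" if "i < d" for i n
    using q that by (intro integrable_Re integrable_W_pow) auto
  have lim: "(\<lambda>n. \<integral>\<omega>. ntrace (W n i \<omega> ^\<^sub>m (2 * q)) \<partial>M n) \<longlonglongrightarrow> of_real (\<integral>x. x ^ (2 * q) \<partial>\<mu> i)"
    if "i < d" for i
    using conv_exp[OF that] q by (auto simp: weak_conv_exp_def conv_in_exp_def)
  have "(\<integral>\<omega>. C q n \<omega> \<partial>M n) = 1 + (\<Sum>i<d. Re (\<integral>\<omega>. ntrace (W n i \<omega> ^\<^sub>m (2 * q)) \<partial>M n))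
      + (\<Sum>i<d. Re (ntrace (E n i ^\<^sub>m q)))" for n
  proof -
    interpret prob_space "M n" by (rule prob)
    define f where "f \<omega> = (\<Sum>i<d. Re (ntrace (W n i \<omega> ^\<^sub>m (2 * q))))" for \<omega>
    have "integrable (M n) f"
      unfolding f_def using int by (intro Bochner_Integration.integrable_sum) auto
    then have "(\<integral>\<omega>. C q n \<omega> \<partial>M n) = 1 + (\<integral>\<omega>. f \<omega> \<partial>M n) + (\<Sum>i<d. Re (ntrace (E n i ^\<^sub>m q)))"
      unfolding C_def f_def[symmetric] by (simp add: prob_space)
    also have "(\<integral>\<omega>. f \<omega> \<partial>M n)
        = (\<Sum>i<d. \<integral>\<omega>. Re (ntrace (W n i \<omega> ^\<^sub>m (2 * q))) \<partial>M n)"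
      unfolding f_def using int by (intro Bochner_Integration.integral_sum) auto
    also have "\<dots> = (\<Sum>i<d. Re (\<integral>\<omega>. ntrace (W n i \<omega> ^\<^sub>m (2 * q)) \<partial>M n))"
      using q by (intro sum.cong refl integral_Re integrable_W_pow) auto
    finally show ?thesis .
  qed
  moreover have "(\<lambda>n. 1 + (\<Sum>i<d. Re (\<integral>\<omega>. ntrace (W n i \<omega> ^\<^sub>m (2 * q)) \<partial>M n)) + (\<Sum>i<d. Re (ntrace (E n i ^\<^sub>m q))))
      \<longlonglongrightarrow> 1 + (\<Sum>i<d. Re (of_real (\<integral>x. x ^ (2 * q) \<partial>\<mu> i))) + (\<Sum>i<d. Re 0)"
    using mean_kron[where p = q] q by (intro tendsto_intros lim) (auto simp: E_def X_def[abs_def])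
  ultimately have "convergent (\<lambda>n. \<integral>\<omega>. C q n \<omega> \<partial>M n)"
    by (simp only: convergentI)
  then have "Bseq (\<lambda>n. \<integral>\<omega>. C q n \<omega> \<partial>M n)" by (rule convergent_imp_Bseq)
  then show ?thesis by (auto simp: Bseq_def abs_le_iff)
qed

section \<open>Limits of words and of powers of the centered sum\<close>

lemma ntrace_E_pow_tendsto:
  assumes "i < d" "1 \<le> q"
  shows "((\<lambda>x. ntrace (E (fst x) i ^\<^sub>m q)) \<longlongrightarrow> 0) (prob_filter M)"
  using mean_kron[OF assms]
  by (intro tendsto_prob_filter_fst[where f = "\<lambda>n. ntrace (E n i ^\<^sub>m q)"]) (auto simp: E_def X_def[abs_def])

text \<open>A finite limit in probability keeps \<open>C\<close> from compensating a vanishing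
  factor in a product.\<close>

lemma C_tendsto:
  assumes q: "1 \<le> q"
  shows "((\<lambda>x. C q (fst x) (snd x)) \<longlongrightarrow>
    1 + (\<Sum>i<d. Re (of_real (\<integral>x. x ^ (2 * q) \<partial>\<mu> i))) + (\<Sum>i<d. Re 0)) (prob_filter M)"
proof -
  have "((\<lambda>x. ntrace (W (fst x) i (snd x) ^\<^sub>m (2 * q))) \<longlongrightarrow> of_real (\<integral>x. x ^ (2 * q) \<partial>\<mu> i)) (prob_filter M)"
    if "i < d" for i
    using conv_prob[OF that] q
    by (intro conv_in_prob_imp_tendsto[where Y = "\<lambda>n \<omega>. ntrace (W n i \<omega> ^\<^sub>m (2 * q))"]) (auto simp: weak_conv_prob_def)
  then show ?thesis
    unfolding C_def using q by (intro tendsto_intros ntrace_E_pow_tendsto) auto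
qed

lemma conv_both_of_dominated:
  assumes "\<And>n. Y n \<in> borel_measurable (M n)"
    and "\<And>n \<omega>. \<omega> \<in> space (M n) \<Longrightarrow> (cmod (Y n \<omega>))\<^sup>2 \<le> C q n \<omega>"
    and "((\<lambda>x. Y (fst x) (snd x)) \<longlongrightarrow> c) (prob_filter M)"
    and q: "1 \<le> q"
  shows "conv_both M Y c"
proof -
  obtain B where B: "\<And>n. (\<integral>\<omega>. C q n \<omega> \<partial>M n) \<le> B" using bounded_integral_C[OF q] by blast
  have conv: "conv_in_prob M Y c" by (rule tendsto_imp_conv_in_prob[OF prob assms(1,3)])
  then show ?thesis
    using conv_in_exp_of_square_dominated[OF prob assms(1,2) integrable_C[OF q] B conv] by (simp add: conv_both_def)
qed

lemma conv_both_L_word: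
  assumes u: "fst ` set u \<subseteq> {..<d}"
  shows "conv_both M (\<lambda>n \<omega>. ntrace (mat_prod_list (n * n) (map (L n \<omega>) u)))
    (if \<exists>i. (i, True) \<in> set u then 0 else (t (map fst u))\<^sup>2)"
    (is "conv_both M ?Y ?c")
proof -
  define q :: nat where "q = 2 ^ Suc (length u)"
  have q: "1 \<le> q" by (simp add: q_def)
  show ?thesis
  proof (rule conv_both_of_dominated[OF _ _ _ q])
    fix n
    have "mat_measurable (M n) (n * n) (\<lambda>\<omega>. mat_prod_list (n * n) (map (\<lambda>A. A \<omega>) (map (\<lambda>y \<omega>. L n \<omega> y) u)))"
      using u by (intro mat_measurable_prod_list) (auto intro!: mat_measurable_L)
    then show "?Y n \<in> borel_measurable (M n)"
      by (intro borel_measurable_ntrace) (simp add: o_def)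
  next
    fix n \<omega> assume \<omega>: "\<omega> \<in> space (M n)"
    show "(cmod (?Y n \<omega>))\<^sup>2 \<le> C q n \<omega>"
      using norm_ntrace_le[OF mat_prod_list_carrier[OF L_carrier[OF u \<omega>]]] ntrace_L_word_le[OF u \<omega> order_refl, folded q_def]
      by (rule order_trans)
  next
    show "((\<lambda>x. ?Y (fst x) (snd x)) \<longlongrightarrow> ?c) (prob_filter M)"
    proof (cases "\<exists>i. (i, True) \<in> set u")
      case True
      then obtain i v w where split: "u = v @ (i, True) # w" by (auto dest: split_list)
      have i: "i < d" and vw: "fst ` set v \<subseteq> {..<d}" "fst ` set w \<subseteq> {..<d}" "fst ` set (w @ v) \<subseteq> {..<d}"
        using u by (auto simp: split)
      \<comment> \<open>Cyclicity brings one mean to the front, and Cauchy-Schwarz splits off its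
        second moment. What remains is \<open>w @ v\<close>, one letter shorter than
        \<open>u\<close> and hence dominated by the same \<open>C q\<close>.\<close>
      have le: "(cmod (?Y n \<omega>))\<^sup>2 \<le> Re (ntrace (E n i ^\<^sub>m 2)) * C q n \<omega>"
        if \<omega>: "\<omega> \<in> space (M n)" for n \<omega>
      proof -
        let ?P = "mat_prod_list (n * n) (map (L n \<omega>) v)" and ?Q = "mat_prod_list (n * n) (map (L n \<omega>) w)"
        have PQ: "?P \<in> carrier_mat (n * n) (n * n)" "?Q \<in> carrier_mat (n * n) (n * n)"
          using L_carrier[OF vw(1) \<omega>] L_carrier[OF vw(2) \<omega>] by auto
        have QP: "?Q * ?P = mat_prod_list (n * n) (map (L n \<omega>) (w @ v))"
          using L_carrier[OF vw(1) \<omega>] L_carrier[OF vw(2) \<omega>] by (simp add: mat_prod_list_append)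
        have "?Y n \<omega> = ntrace (?P * (E n i * ?Q))"
          using L_carrier[OF u \<omega>] by (simp add: split mat_prod_list_append L_def)
        also have "\<dots> = ntrace (E n i * ?Q * ?P)"
          using PQ mult_carrier_mat[OF E_carrier PQ(2)]
          by (subst ntrace_mult_commute[of _ "n * n"]) auto
        also have "\<dots> = ntrace (E n i * (?Q * ?P))"
          using PQ by (simp add: assoc_mult_mat[of _ "n * n" "n * n" _ "n * n" _ "n * n"])
        finally have "(cmod (?Y n \<omega>))\<^sup>2 \<le> Re (ntrace (mat_adjoint (E n i) * E n i))
            * Re (ntrace (mat_adjoint (?Q * ?P) * (?Q * ?P)))"
          using ntrace_Cauchy_Schwarz[OF E_carrier[of n i] mult_carrier_mat[OF PQ(2,1)]] by simp
        also have "Re (ntrace (mat_adjoint (E n i) * E n i)) = Re (ntrace (E n i ^\<^sub>m 2))"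
          using E_carrier[of n i] by (simp add: E_hermitian[OF i] numeral_2_eq_2 left_mult_one_mat')
        also have "Re (ntrace (E n i ^\<^sub>m 2)) * Re (ntrace (mat_adjoint (?Q * ?P) * (?Q * ?P)))
            \<le> Re (ntrace (E n i ^\<^sub>m 2)) * C q n \<omega>"
          unfolding QP using ntrace_L_word_le[OF vw(3) \<omega>, of "length u", folded q_def] ntrace_E_pow_nonneg[OF i, of 2 n]
          by (intro mult_left_mono) (auto simp: split)
        finally show ?thesis .
      qed
      obtain c where c: "((\<lambda>x. C q (fst x) (snd x)) \<longlongrightarrow> c) (prob_filter M)"
        using C_tendsto[OF q] by blast
      have E: "((\<lambda>x. ntrace (E (fst x) i ^\<^sub>m 2)) \<longlongrightarrow> 0) (prob_filter M)"
        by (rule ntrace_E_pow_tendsto[OF i]) simp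
      have "((\<lambda>x. Re (ntrace (E (fst x) i ^\<^sub>m 2)) * C q (fst x) (snd x)) \<longlongrightarrow> 0 * c) (prob_filter M)"
        using tendsto_mult[OF tendsto_Re[OF E] c] by simp
      then have lim0: "((\<lambda>x. Re (ntrace (E (fst x) i ^\<^sub>m 2)) * C q (fst x) (snd x)) \<longlongrightarrow> 0) (prob_filter M)"
        by simp
      have "((\<lambda>x. (cmod (?Y (fst x) (snd x)))\<^sup>2) \<longlongrightarrow> 0) (prob_filter M)"
      proof (rule tendsto_sandwich[OF _ _ tendsto_const lim0])
        show "\<forall>\<^sub>F x in prob_filter M. (cmod (?Y (fst x) (snd x)))\<^sup>2
            \<le> Re (ntrace (E (fst x) i ^\<^sub>m 2)) * C q (fst x) (snd x)"
          using eventually_prob_filter_space by eventually_elim (rule le)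
      qed auto
      from tendsto_real_sqrt[OF this] show ?thesis using True by (simp add: tendsto_norm_zero_iff)
    next
      case False
      then have X: "map (L n \<omega>) u = map (\<lambda>A. kron A (mat_conj A)) (map (\<lambda>i. W n i \<omega>) (map fst u))" for n \<omega>
        by (auto simp: L_def X_def)
      have fu: "set (map fst u) \<subseteq> {..<d}" using u by simp
      have lim: "((\<lambda>x. of_real ((cmod (ntrace (mat_prod_list (fst x) (map (\<lambda>i. W (fst x) i (snd x)) (map fst u)))))\<^sup>2))
          \<longlongrightarrow> complex_of_real ((cmod (t (map fst u)))\<^sup>2)) (prob_filter M)"
        by (intro tendsto_intros word fu)
      \<comment> \<open>Here the reality of the limit is used.\<close>
      have "complex_of_real ((cmod (t (map fst u)))\<^sup>2) = (t (map fst u))\<^sup>2"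
      proof -
        obtain r where "t (map fst u) = of_real r" using word_real[OF fu] by (auto elim: Reals_cases)
        then show ?thesis by simp
      qed
      moreover have "\<forall>\<^sub>F x in prob_filter M.
          of_real ((cmod (ntrace (mat_prod_list (fst x) (map (\<lambda>i. W (fst x) i (snd x)) (map fst u)))))\<^sup>2)
          = ?Y (fst x) (snd x)"
        using eventually_prob_filter_space
      proof eventually_elim
        case (elim x)
        have "set (map (\<lambda>i. W (fst x) i (snd x)) (map fst u)) \<subseteq> carrier_mat (fst x) (fst x)"
          using fu carrier[OF _ elim] by auto
        then show ?case unfolding X by (rule ntrace_word_kron_conj[symmetric])
      qed
      ultimately show ?thesis using Lim_transform_eventually[OF lim] False by auto
    qed
  qed
qed

lemma sum_words_Suc:
  fixes f :: "nat list \<Rightarrow> complex"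
  shows "(\<Sum>is\<in>{is. set is \<subseteq> {..<d} \<and> length is = Suc p}. f is)
    = (\<Sum>i<d. \<Sum>is\<in>{is. set is \<subseteq> {..<d} \<and> length is = p}. f (i # is))"
  unfolding sum.cartesian_product
  by (rule sum.reindex_bij_witness[where i = "\<lambda>(i, is). i # is" and j = "\<lambda>is. (hd is, tl is)"])
    (auto simp: length_Suc_conv)

text \<open>The prefix \<open>u\<close> lets the factors of the power be absorbed one at a time:
  each becomes a letter \<open>X\<close> or, with a minus sign, a letter \<open>E\<close>. Once the
  prefix contains a mean, the limit is 0 whatever follows.\<close>

lemma conv_both_L_word_S_pow:
  assumes "fst ` set u \<subseteq> {..<d}"
  shows "conv_both M (\<lambda>n \<omega>. ntrace (mat_prod_list (n * n) (map (L n \<omega>) u) * S n \<omega> ^\<^sub>m p))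
    (if \<exists>i. (i, True) \<in> set u then 0
     else (\<Sum>is\<in>{is. set is \<subseteq> {..<d} \<and> length is = p}. (t (map fst u @ is))\<^sup>2))"
  using assms
proof (induction p arbitrary: u)
  case 0
  have "{is. set is \<subseteq> {..<d} \<and> length is = 0} = {[]}" by auto
  then have sum_0: "(\<Sum>is\<in>{is. set is \<subseteq> {..<d} \<and> length is = 0}. (t (map fst u @ is))\<^sup>2) = (t (map fst u))\<^sup>2"
    by (simp only:) simp
  have word_0: "ntrace (mat_prod_list (n * n) (map (L n \<omega>) u) * S n \<omega> ^\<^sub>m 0)
      = ntrace (mat_prod_list (n * n) (map (L n \<omega>) u))" if "\<omega> \<in> space (M n)" for n \<omega>
    using mat_prod_list_carrier[OF L_carrier[OF 0 that]] S_carrier[of n \<omega>]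
    by (simp add: right_mult_one_mat[of _ "n * n" "n * n"] del: map_map)
  show ?case
    unfolding sum_0 by (rule conv_both_cong[THEN iffD2, OF word_0 conv_both_L_word[OF 0]])
next
  case (Suc p)
  let ?Y = "\<lambda>u n \<omega>. ntrace (mat_prod_list (n * n) (map (L n \<omega>) u) * S n \<omega> ^\<^sub>m p)"
  let ?c = "\<lambda>u. if \<exists>i. (i, True) \<in> set u then 0
     else (\<Sum>is\<in>{is. set is \<subseteq> {..<d} \<and> length is = p}. (t (map fst u @ is))\<^sup>2)"
  have conv: "conv_both M (\<lambda>n \<omega>. \<Sum>i<d. ?Y (u @ [(i, False)]) n \<omega> - ?Y (u @ [(i, True)]) n \<omega>)
      (\<Sum>i<d. ?c (u @ [(i, False)]) - ?c (u @ [(i, True)]))"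
    using Suc.prems by (intro conv_both_sum conv_both_diff prob Suc.IH) auto
  have sum_Suc: "(\<Sum>i<d. ?c (u @ [(i, False)]) - ?c (u @ [(i, True)]))
      = (if \<exists>i. (i, True) \<in> set u then 0
         else (\<Sum>is\<in>{is. set is \<subseteq> {..<d} \<and> length is = Suc p}. (t (map fst u @ is))\<^sup>2))"
  proof -
    have "?c (u @ [(i, True)]) = 0" for i by (rule if_P) auto
    then show ?thesis by (simp add: sum_words_Suc)
  qed
  have word_Suc: "ntrace (mat_prod_list (n * n) (map (L n \<omega>) u) * S n \<omega> ^\<^sub>m Suc p)
      = (\<Sum>i<d. ?Y (u @ [(i, False)]) n \<omega> - ?Y (u @ [(i, True)]) n \<omega>)" if \<omega>: "\<omega> \<in> space (M n)" for n \<omega>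
  proof -
    let ?N = "n * n"
    let ?P = "mat_prod_list ?N (map (L n \<omega>) u)" and ?R = "S n \<omega> ^\<^sub>m p"
    have P: "?P \<in> carrier_mat ?N ?N" by (rule mat_prod_list_carrier[OF L_carrier[OF Suc.prems \<omega>]])
    have R: "?R \<in> carrier_mat ?N ?N" by simp
    note mult = mult_carrier_mat[of _ ?N ?N _ ?N] and assoc = assoc_mult_mat[of _ ?N ?N _ ?N _ ?N]
    have "ntrace (?P * S n \<omega> ^\<^sub>m Suc p) = ntrace (?P * (mat_sum ?N (\<lambda>i. X n i \<omega> - E n i) {..<d} * ?R))"
      by (simp only: pow_mat_Suc_left[OF S_carrier]) (simp only: S_def)
    also have "\<dots> = (\<Sum>i<d. ntrace (?P * ((X n i \<omega> - E n i) * ?R)))"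
      using P R by (intro ntrace_mult_sum_mult) (auto intro: minus_carrier_mat)
    also have "\<dots> = (\<Sum>i<d. ?Y (u @ [(i, False)]) n \<omega> - ?Y (u @ [(i, True)]) n \<omega>)"
    proof (intro sum.cong refl)
      fix i assume "i \<in> {..<d}"
      then have i: "i < d" by simp
      note X = X_carrier[OF i \<omega>] and E = E_carrier[of n i]
      have app: "mat_prod_list ?N (map (L n \<omega>) (u @ [(i, e)])) = ?P * L n \<omega> (i, e)" for e
      proof -
        have "L n \<omega> (i, e) \<in> carrier_mat ?N ?N" using X E by (simp add: L_def)
        then show ?thesis
          using L_carrier[OF Suc.prems \<omega>]
          by (simp add: mat_prod_list_append right_mult_one_mat[of _ ?N ?N])
      qed
      have "?P * ((X n i \<omega> - E n i) * ?R) = ?P * (X n i \<omega>) * ?R - ?P * E n i * ?R"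
        using P R X E
        by (simp add: minus_mult_distrib_mat[OF X E R] mult_minus_distrib_mat[OF P mult[OF X R] mult[OF E R]] assoc)
      then show "ntrace (?P * ((X n i \<omega> - E n i) * ?R))
          = ?Y (u @ [(i, False)]) n \<omega> - ?Y (u @ [(i, True)]) n \<omega>"
        unfolding app using P R X E by (simp add: L_def ntrace_diff[of _ ?N] mult)
    qed
    finally show ?thesis .
  qed
  show ?case
    by (rule conv_both_cong[THEN iffD2, OF word_Suc conv[unfolded sum_Suc]])
qed

lemma conv_both_S_pow:
  "conv_both M (\<lambda>n \<omega>. ntrace (S n \<omega> ^\<^sub>m p))
    (\<Sum>is\<in>{is. set is \<subseteq> {..<d} \<and> length is = p}. (t is)\<^sup>2)"
proof -
  have "mat_prod_list (n * n) (map (L n \<omega>) []) * S n \<omega> ^\<^sub>m p = S n \<omega> ^\<^sub>m p" for n \<omega>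
    by (simp add: left_mult_one_mat[of _ "n * n" "n * n"])
  then show ?thesis using conv_both_L_word_S_pow[of "[]" p] by simp
qed

lemma conv_both_scaled_S_pow:
  "conv_both M (\<lambda>n \<omega>. ntrace ((complex_of_real r \<cdot>\<^sub>m S n \<omega>) ^\<^sub>m p))
    (complex_of_real r ^ p * (\<Sum>is\<in>{is. set is \<subseteq> {..<d} \<and> length is = p}. (t is)\<^sup>2))"
proof -
  have "ntrace ((complex_of_real r \<cdot>\<^sub>m S n \<omega>) ^\<^sub>m p) = complex_of_real r ^ p * ntrace (S n \<omega> ^\<^sub>m p)" for n \<omega>
    by (simp add: smult_pow_mat[of _ "n * n"] ntrace_smult[of _ "n * n"])
  then show ?thesis using conv_both_mult_left[OF prob conv_both_S_pow] by simp
qed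

text \<open>All moments converge along one filter, so finitely many of them are close to their
  limits at a common outcome with positive \<open>n\<close>. Such outcomes supply the Hermitian
  matrices from which the measure is obtained.\<close>

lemma scaled_S_limit_measure:
  "\<exists>\<nu>. moment_measure \<nu> \<and> (\<forall>p. complex_of_real (\<integral>x. x ^ p \<partial>\<nu>) =
    complex_of_real r ^ p * (\<Sum>is\<in>{is. set is \<subseteq> {..<d} \<and> length is = p}. (t is)\<^sup>2))"
proof -
  define c where "c p = complex_of_real r ^ p * (\<Sum>is\<in>{is. set is \<subseteq> {..<d} \<and> length is = p}. (t is)\<^sup>2)" for p
  have "c p \<in> \<real>" for p unfolding c_def using word_real by (auto intro!: Reals_mult Reals_power sum_in_Reals)
  then have c_real: "complex_of_real (Re (c p)) = c p" for p by simp
  let ?D = "\<lambda>n \<omega>. complex_of_real r \<cdot>\<^sub>m S n \<omega>"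
  have "\<exists>\<nu>. moment_measure \<nu> \<and> (\<forall>p. (\<integral>x. x ^ p \<partial>\<nu>) = Re (c p))"
  proof (rule hermitian_moment_limit)
    fix k :: nat
    have "((\<lambda>x. ntrace (?D (fst x) (snd x) ^\<^sub>m p)) \<longlongrightarrow> c p) (prob_filter M)" for p
      using conv_in_prob_imp_tendsto[of M "\<lambda>n \<omega>. ntrace (?D n \<omega> ^\<^sub>m p)" "c p"] conv_both_scaled_S_pow[of r p]
      by (simp add: conv_both_def c_def)
    then have "\<forall>\<^sub>F x in prob_filter M. \<forall>p\<in>{..k}. dist (ntrace (?D (fst x) (snd x) ^\<^sub>m p)) (c p) < 1 / real (Suc k)"
      by (intro eventually_ball_finite ballI tendstoD) auto
    with eventually_prob_filter_fst[OF eventually_gt_at_top[of 0], of M]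
    have "\<forall>\<^sub>F x in prob_filter M. 0 < fst x \<and>
        (\<forall>p\<in>{..k}. dist (ntrace (?D (fst x) (snd x) ^\<^sub>m p)) (c p) < 1 / real (Suc k))"
      by eventually_elim blast
    from eventually_prob_filter_ex[OF prob this] obtain n \<omega> where n: "\<omega> \<in> space (M n)" "0 < n"
      "\<forall>p\<in>{..k}. dist (ntrace (?D n \<omega> ^\<^sub>m p)) (c p) < 1 / real (Suc k)" by auto
    have "mat_adjoint (?D n \<omega>) = ?D n \<omega>"
    proof (rule eq_matI)
      fix i j assume "i < dim_row (?D n \<omega>)" "j < dim_col (?D n \<omega>)"
      then have ij: "i < n * n" "j < n * n" using S_carrier[of n \<omega>] by auto
      have "cnj (S n \<omega> $$ (j, i)) = S n \<omega> $$ (i, j)"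
        using index_mat_adjoint[of i "S n \<omega>" j] ij S_carrier[of n \<omega>] by (simp add: S_hermitian[OF n(1)])
      then show "mat_adjoint (?D n \<omega>) $$ (i, j) = ?D n \<omega> $$ (i, j)"
        using ij by (subst index_mat_adjoint) auto
    qed (use S_carrier[of n \<omega>] in auto)
    with n show "\<exists>N A. 0 < N \<and> A \<in> carrier_mat N N \<and> mat_adjoint A = A \<and>
        (\<forall>p\<le>k. cmod (ntrace (A ^\<^sub>m p) - complex_of_real (Re (c p))) < 1 / real (Suc k))"
      by (intro exI[of _ "n * n"] exI[of _ "?D n \<omega>"]) (auto simp: c_real dist_norm)
  qed
  then show ?thesis using c_real by (metis c_def)
qed

end

theorem theorem2p1:
  fixes d :: nat
    and M :: "nat \<Rightarrow> 'a measure"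
    and W :: "nat \<Rightarrow> nat \<Rightarrow> 'a \<Rightarrow> complex mat"
    and \<mu> :: "nat \<Rightarrow> real measure"
    and sc :: "complex \<Rightarrow> 'b::ring_1 \<Rightarrow> 'b" and star :: "'b \<Rightarrow> 'b" and \<tau> :: "'b \<Rightarrow> complex"
    and a :: "nat \<Rightarrow> 'b"
    and \<Delta> :: "nat \<Rightarrow> 'a \<Rightarrow> complex mat"
  assumes d: "1 \<le> d"
    and prob: "\<And>n. prob_space (M n)"
    and carrier: "\<And>n i \<omega>. i < d \<Longrightarrow> \<omega> \<in> space (M n) \<Longrightarrow> W n i \<omega> \<in> carrier_mat n n"
    and herm: "\<And>n i \<omega>. i < d \<Longrightarrow> \<omega> \<in> space (M n) \<Longrightarrow> mat_adjoint (W n i \<omega>) = W n i \<omega>"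
    and meas: "\<And>n i j k. i < d \<Longrightarrow> j < n \<Longrightarrow> k < n \<Longrightarrow>
                 (\<lambda>\<omega>. W n i \<omega> $$ (j, k)) \<in> borel_measurable (M n)"
    and centered: "\<And>n i. i < d \<Longrightarrow> mat_expect (M n) n (W n i) = 0\<^sub>m n n"
    and A1_prob: "\<And>i. i < d \<Longrightarrow> weak_conv_prob M (\<lambda>n. W n i) (\<mu> i)"
    and A1_exp: "\<And>i. i < d \<Longrightarrow> weak_conv_exp M (\<lambda>n. W n i) (\<mu> i)"
    and A2_prob: "asym_free_prob M (\<lambda>n. n) d W"
    and A2_exp: "asym_free_exp M (\<lambda>n. n) d W"
    and A3: "\<And>i p. i < d \<Longrightarrow> 1 \<le> p \<Longrightarrow>
      (\<lambda>n. ntrace (mat_expect (M n) (n * n) (\<lambda>\<omega>. kron (W n i \<omega>) (mat_conj (W n i \<omega>))) ^\<^sub>m p))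
        \<longlonglongrightarrow> 0"
    and Delta: "\<And>n \<omega>. \<Delta> n \<omega> = complex_of_real (1 / sqrt (real d)) \<cdot>\<^sub>m
      mat_sum (n * n) (\<lambda>i. kron (W n i \<omega>) (mat_conj (W n i \<omega>)) -
         mat_expect (M n) (n * n) (\<lambda>\<omega>'. kron (W n i \<omega>') (mat_conj (W n i \<omega>')))) {..<d}"
    and ncps: "nc_prob_space sc star \<tau>"
    and free: "free_vars sc \<tau> {..<d} a"
    and selfadj: "\<And>i. i < d \<Longrightarrow> star (a i) = a i"
    and distr: "\<And>i p. i < d \<Longrightarrow> \<tau> (a i ^ p) = complex_of_real (\<integral>x. x ^ p \<partial>\<mu> i)"
  shows "\<exists>\<nu>. weak_conv_prob M \<Delta> \<nu> \<and> weak_conv_exp M \<Delta> \<nu> \<and>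
     (\<forall>p\<ge>1. complex_of_real (\<integral>x. x ^ p \<partial>\<nu>) =
        complex_of_real (real d powr (- real p / 2)) *
        (\<Sum>is\<in>{is. set is \<subseteq> {..<d} \<and> length is = p}. (\<tau> (prod_list (map a is))) ^ 2))"
proof -
  \<comment> \<open>The limits of the word traces are the mixed moments of the free
    variables.\<close>
  interpret kron_conj_sum d M W \<mu> "\<lambda>ws. \<tau> (prod_list (map a ws))"
    by (rule kron_conj_sum.intro[OF prob carrier herm meas A1_prob A1_exp A3
          tendsto_ntrace_word[OF carrier A1_prob A2_prob ncps free distr]])
  let ?r = "1 / sqrt (real d)"
  have Delta_S: "\<Delta> n \<omega> = complex_of_real ?r \<cdot>\<^sub>m S n \<omega>" for n \<omega>
    by (simp add: Delta S_def X_def E_def[unfolded X_def[abs_def]])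
  obtain \<nu> where \<nu>: "moment_measure \<nu>" "\<And>p. complex_of_real (\<integral>x. x ^ p \<partial>\<nu>) =
      complex_of_real ?r ^ p * (\<Sum>is\<in>{is. set is \<subseteq> {..<d} \<and> length is = p}. (\<tau> (prod_list (map a is)))\<^sup>2)"
    using scaled_S_limit_measure[of ?r] by auto
  have conv: "conv_both M (\<lambda>n \<omega>. ntrace (\<Delta> n \<omega> ^\<^sub>m p)) (complex_of_real (\<integral>x. x ^ p \<partial>\<nu>))" for p
    unfolding \<nu>(2) Delta_S by (rule conv_both_scaled_S_pow)
  have carr: "\<Delta> n \<omega> \<in> carrier_mat (n * n) (n * n)" for n \<omega>
    unfolding Delta_S by simp
  \<comment> \<open>\<open>1 \<le> d\<close> provides the positive base needed to rewrite powers of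
    the normalization by \<open>powr\<close>.\<close>
  have "?r = real d powr (- (1 / 2))"
    using d by (simp add: powr_minus powr_half_sqrt inverse_eq_divide)
  then have "?r ^ p = real d powr (- real p / 2)" for p
    using d by (simp add: powr_powr flip: powr_realpow)
  then have "complex_of_real ?r ^ p = complex_of_real (real d powr (- real p / 2))" for p
    by (simp only: of_real_power[symmetric])
  with weak_conv_of_moments[OF \<nu>(1) carr conv] \<nu>(2) show ?thesis by (intro exI[of _ \<nu>]) metis
qed

end
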